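(* Let $(\mathscr{C},\mathbf{W})$ satisfy conditions (BF). Let $A,B$ be objects, let $\underline{f}^m:=(A^m,w^m,f^m):A\to B$ for $m=1,2$ be morphisms of $\mathscr{C}[\mathbf{W}^{-1}]$, and let $\Gamma,\Gamma':\underline{f}^1\Rightarrow\underline{f}^2$ be 2-morphisms of $\mathscr{C}[\mathbf{W}^{-1}]$. Then there are an object $A^3$, a morphism $v^1:A^3\to A^1$ in $\mathbf{W}$, a morphism $v^2:A^3\to A^2$, an invertible 2-morphism $\alpha:w^1\circ v^1\Rightarrow w^2\circ v^2$ and a pair of 2-morphisms $\gamma,\gamma':f^1\circ v^1\Rightarrow f^2\circ v^2$ such that $$\Gamma=[A^3,v^1,v^2,\alpha,\gamma]\quad\text{and}\quad\Gamma'=[A^3,v^1,v^2,\alpha,\gamma'].\qquad( * )$$ Moreover, given any pair of 2-morphisms $\Gamma,\Gamma':\underline{f}^1\Rightarrow\underline{f}^2$ with representatives satisfying $( * )$, the following facts are equivalent: (i) $\Gamma=\Gamma'$; (ii) there are an object $A^4$ and a morphism $z:A^4\to A^3$ in $\mathbf{W}$ such that $\gamma\circ z=\gamma'\circ z$; (iii) there are an object $A^4$ and a morphism $z:A^4\to A^3$ such that $v^1\circ z$ belongs to $\mathbf{W}$ and $\gamma\circ z=\gamma'\circ z$.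
   Context: Conventions. $\mathscr{C}$ is a bicategory and $\mathbf{W}$ a class of 1-morphisms in it. $\circ$ denotes composition of 1-morphisms and whiskering of 2-morphisms by 1-morphisms; $\bullet$ denotes vertical composition of 2-morphisms ($\beta\bullet\alpha$ means first $\alpha$, then $\beta$). Associators and unitors of $\mathscr{C}$ are omitted from the notation, as if $\mathscr{C}$ were a 2-category (by coherence they can be inserted unambiguously); the statement is meant for arbitrary bicategories. Conditions (BF) on $(\mathscr{C},\mathbf{W})$: (BF1) every $\mathrm{id}_A$ is in $\mathbf{W}$. (BF2) $\mathbf{W}$ is closed under composition. (BF3) For every $w:A\to B$ in $\mathbf{W}$ and every $f:C\to B$ there are an object $D$, $w':D\to C$ in $\mathbf{W}$, $f':D\to A$ and an invertible 2-morphism $f\circ w'\Rightarrow w\circ f'$. (BF4a) For every $w:B\to A$ in $\mathbf{W}$, $f^1,f^2:C\to B$ and $\alpha:w\circ f^1\Rightarrow w\circ f^2$ there are an object $D$, $v:D\to C$ in $\mathbf{W}$ and $\beta:f^1\circ v\Rightarrow f^2\circ v$ with $\alpha\circ v=w\circ\beta$. (BF4b) If $\alpha$ in (BF4a) is invertible, so is $\beta$. (BF4c) If $(D',v',\beta')$ is another triple with the same properties as $(D,v,\beta)$ in (BF4a), there are an object $E$, $u:E\to D$, $u':E\to D'$ and an invertible $\zeta:v\circ u\Rightarrow v'\circ u'$ with $v\circ u\in\mathbf{W}$ and $(\beta'\circ u')\bullet(f^1\circ\zeta)=(f^2\circ\zeta)\bullet(\beta\circ u)$. (BF5) If $w:A\to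 B$ is in $\mathbf{W}$, $v:A\to B$ is any morphism and there is an invertible $v\Rightarrow w$, then $v\in\mathbf{W}$. Bicategory of fractions $\mathscr{C}[\mathbf{W}^{-1}]$ (Pronk). Its objects are those of $\mathscr{C}$. A morphism $A\to B$ is a triple $(A',w,f)$ with $w:A'\to A$ in $\mathbf{W}$ and $f:A'\to B$. A 2-morphism from $(A^1,w^1,f^1)$ to $(A^2,w^2,f^2)$ (both $A\to B$) is an equivalence class $[A^3,v^1,v^2,\alpha,\beta]$ of data (its representatives) with $v^m:A^3\to A^m$ ($m=1,2$), $w^1\circ v^1\in\mathbf{W}$, $\alpha:w^1\circ v^1\Rightarrow w^2\circ v^2$ invertible and $\beta:f^1\circ v^1\Rightarrow f^2\circ v^2$. Data $(A^3,v^1,v^2,\alpha,\beta)$ and $(A'^3,v'^1,v'^2,\alpha',\beta')$ are equivalent iff there are an object $A^4$, morphisms $z:A^4\to A^3$, $z':A^4\to A'^3$ and invertible $\sigma^1:v'^1\circ z'\Rightarrow v^1\circ z$, $\sigma^2:v^2\circ z\Rightarrow v'^2\circ z'$ such that $w^1\circ v^1\circ z\in\mathbf{W}$, $(w^2\circ\sigma^2)\bullet(\alpha\circ z)\bullet(w^1\circ\sigma^1)=\alpha'\circ z'$ and $(f^2\circ\sigma^2)\bullet(\beta\circ z)\bullet(f^1\circ\sigma^1)=\beta'\circ z'$. This is an equivalence relation. *)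

theory Defs
  imports Main
begin

section \<open>Bicategories\<close>

text \<open>
  Composition is written in the applicative order: in \<open>g \<odot> f\<close>, \<open>\<beta> \<star> \<alpha>\<close> and \<open>\<beta> \<bullet> \<alpha>\<close> the right
  argument comes first.  Here \<open>\<odot>\<close> is composition of 1-cells, \<open>\<star>\<close> horizontal and \<open>\<bullet>\<close> vertical
  composition of 2-cells.  All operations are meaningful only on composable cells of the carriers.
\<close>

record ('o, 'm, 'c) bicat =
  Obj :: "'o set"
  Mor :: "'m set"
  Cell :: "'c set"
  src :: "'m \<Rightarrow> 'o"
  trg :: "'m \<Rightarrow> 'o"
  dom2 :: "'c \<Rightarrow> 'm"
  cod2 :: "'c \<Rightarrow> 'm"
  id1 :: "'o \<Rightarrow> 'm"
  comp1 :: "'m \<Rightarrow> 'm \<Rightarrow> 'm"  (infixl "\<odot>\<index>" 75)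
  id2 :: "'m \<Rightarrow> 'c"
  vcomp :: "'c \<Rightarrow> 'c \<Rightarrow> 'c"  (infixr "\<bullet>\<index>" 60)
  hcomp :: "'c \<Rightarrow> 'c \<Rightarrow> 'c"  (infixl "\<star>\<index>" 70)
  assoc :: "'m \<Rightarrow> 'm \<Rightarrow> 'm \<Rightarrow> 'c"
  lunit :: "'m \<Rightarrow> 'c"
  runit :: "'m \<Rightarrow> 'c"

definition hom1 :: "('o, 'm, 'c) bicat \<Rightarrow> 'o \<Rightarrow> 'o \<Rightarrow> 'm set" where
  "hom1 C A B = {f \<in> Mor C. src C f = A \<and> trg C f = B}"

definition hom2 :: "('o, 'm, 'c) bicat \<Rightarrow> 'm \<Rightarrow> 'm \<Rightarrow> 'c set" where
  "hom2 C f g = {\<alpha> \<in> Cell C. dom2 C \<alpha> = f \<and> cod2 C \<alpha> = g}"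

definition is_inverse2 :: "('o, 'm, 'c) bicat \<Rightarrow> 'c \<Rightarrow> 'c \<Rightarrow> bool" where
  "is_inverse2 C \<alpha> \<beta> \<longleftrightarrow>
     \<beta> \<in> hom2 C (cod2 C \<alpha>) (dom2 C \<alpha>) \<and>
     \<beta> \<bullet>\<^bsub>C\<^esub> \<alpha> = id2 C (dom2 C \<alpha>) \<and> \<alpha> \<bullet>\<^bsub>C\<^esub> \<beta> = id2 C (cod2 C \<alpha>)"

definition iso2 :: "('o, 'm, 'c) bicat \<Rightarrow> 'm \<Rightarrow> 'm \<Rightarrow> 'c set" where
  "iso2 C f g = {\<alpha> \<in> hom2 C f g. \<exists>\<beta>. is_inverse2 C \<alpha> \<beta>}"

definition inv2 :: "('o, 'm, 'c) bicat \<Rightarrow> 'c \<Rightarrow> 'c" where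
  "inv2 C \<alpha> = (THE \<beta>. is_inverse2 C \<alpha> \<beta>)"

locale bicategory =
  fixes C :: "('o, 'm, 'c) bicat" (structure)
  assumes src_Obj: "f \<in> Mor C \<Longrightarrow> src C f \<in> Obj C"
    and trg_Obj: "f \<in> Mor C \<Longrightarrow> trg C f \<in> Obj C"
    and dom2_Mor: "\<alpha> \<in> Cell C \<Longrightarrow> dom2 C \<alpha> \<in> Mor C"
    and cod2_Mor: "\<alpha> \<in> Cell C \<Longrightarrow> cod2 C \<alpha> \<in> Mor C"
    and src_parallel: "\<alpha> \<in> Cell C \<Longrightarrow> src C (dom2 C \<alpha>) = src C (cod2 C \<alpha>)"
    and trg_parallel: "\<alpha> \<in> Cell C \<Longrightarrow> trg C (dom2 C \<alpha>) = trg C (cod2 C \<alpha>)"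
    and id1_hom: "A \<in> Obj C \<Longrightarrow> id1 C A \<in> hom1 C A A"
    and comp1_hom: "\<lbrakk>f \<in> hom1 C X Y; g \<in> hom1 C Y Z\<rbrakk> \<Longrightarrow> g \<odot> f \<in> hom1 C X Z"
    and id2_hom: "f \<in> Mor C \<Longrightarrow> id2 C f \<in> hom2 C f f"
    and vcomp_hom: "\<lbrakk>\<alpha> \<in> hom2 C f g; \<beta> \<in> hom2 C g h\<rbrakk> \<Longrightarrow> \<beta> \<bullet> \<alpha> \<in> hom2 C f h"
    and vcomp_id_left: "\<alpha> \<in> hom2 C f g \<Longrightarrow> id2 C g \<bullet> \<alpha> = \<alpha>"
    and vcomp_id_right: "\<alpha> \<in> hom2 C f g \<Longrightarrow> \<alpha> \<bullet> id2 C f = \<alpha>"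
    and vcomp_assoc: "\<lbrakk>\<alpha> \<in> hom2 C f g; \<beta> \<in> hom2 C g h; \<gamma> \<in> hom2 C h k\<rbrakk>
          \<Longrightarrow> (\<gamma> \<bullet> \<beta>) \<bullet> \<alpha> = \<gamma> \<bullet> (\<beta> \<bullet> \<alpha>)"
    and hcomp_hom: "\<lbrakk>f \<in> hom1 C X Y; g \<in> hom1 C Y Z; \<alpha> \<in> hom2 C f f'; \<beta> \<in> hom2 C g g'\<rbrakk>
          \<Longrightarrow> \<beta> \<star> \<alpha> \<in> hom2 C (g \<odot> f) (g' \<odot> f')"
    and hcomp_id2: "\<lbrakk>f \<in> hom1 C X Y; g \<in> hom1 C Y Z\<rbrakk>
          \<Longrightarrow> id2 C g \<star> id2 C f = id2 C (g \<odot> f)"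
    and interchange: "\<lbrakk>f \<in> hom1 C X Y; g \<in> hom1 C Y Z;
          \<alpha> \<in> hom2 C f f'; \<alpha>' \<in> hom2 C f' f''; \<beta> \<in> hom2 C g g'; \<beta>' \<in> hom2 C g' g''\<rbrakk>
          \<Longrightarrow> (\<beta>' \<bullet> \<beta>) \<star> (\<alpha>' \<bullet> \<alpha>) = (\<beta>' \<star> \<alpha>') \<bullet> (\<beta> \<star> \<alpha>)"
    and assoc_iso: "\<lbrakk>f \<in> hom1 C X Y; g \<in> hom1 C Y Z; h \<in> hom1 C Z U\<rbrakk>
          \<Longrightarrow> assoc C h g f \<in> iso2 C ((h \<odot> g) \<odot> f) (h \<odot> (g \<odot> f))"
    and assoc_natural: "\<lbrakk>f \<in> hom1 C X Y; g \<in> hom1 C Y Z; h \<in> hom1 C Z U;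
          \<alpha> \<in> hom2 C f f'; \<beta> \<in> hom2 C g g'; \<gamma> \<in> hom2 C h h'\<rbrakk>
          \<Longrightarrow> assoc C h' g' f' \<bullet> ((\<gamma> \<star> \<beta>) \<star> \<alpha>) = (\<gamma> \<star> (\<beta> \<star> \<alpha>)) \<bullet> assoc C h g f"
    and lunit_iso: "f \<in> hom1 C X Y \<Longrightarrow> lunit C f \<in> iso2 C (id1 C Y \<odot> f) f"
    and lunit_natural: "\<lbrakk>f \<in> hom1 C X Y; \<alpha> \<in> hom2 C f f'\<rbrakk>
          \<Longrightarrow> lunit C f' \<bullet> (id2 C (id1 C Y) \<star> \<alpha>) = \<alpha> \<bullet> lunit C f"
    and runit_iso: "f \<in> hom1 C X Y \<Longrightarrow> runit C f \<in> iso2 C (f \<odot> id1 C X) f"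
    and runit_natural: "\<lbrakk>f \<in> hom1 C X Y; \<alpha> \<in> hom2 C f f'\<rbrakk>
          \<Longrightarrow> runit C f' \<bullet> (\<alpha> \<star> id2 C (id1 C X)) = \<alpha> \<bullet> runit C f"
    and pentagon: "\<lbrakk>f \<in> hom1 C X Y; g \<in> hom1 C Y Z; h \<in> hom1 C Z U; k \<in> hom1 C U V\<rbrakk>
          \<Longrightarrow> (id2 C k \<star> assoc C h g f) \<bullet> assoc C k (h \<odot> g) f \<bullet> (assoc C k h g \<star> id2 C f)
            = assoc C k h (g \<odot> f) \<bullet> assoc C (k \<odot> h) g f"
    and triangle: "\<lbrakk>f \<in> hom1 C X Y; g \<in> hom1 C Y Z\<rbrakk>
          \<Longrightarrow> (id2 C g \<star> lunit C f) \<bullet> assoc C g (id1 C Y) f = runit C g \<star> id2 C f"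

definition lwhisker :: "('o, 'm, 'c) bicat \<Rightarrow> 'm \<Rightarrow> 'c \<Rightarrow> 'c"  (infixl "\<triangleleft>\<index>" 70) where
  "w \<triangleleft>\<^bsub>C\<^esub> \<alpha> = id2 C w \<star>\<^bsub>C\<^esub> \<alpha>"

definition rwhisker :: "('o, 'm, 'c) bicat \<Rightarrow> 'c \<Rightarrow> 'm \<Rightarrow> 'c"  (infixl "\<triangleright>\<index>" 70) where
  "\<alpha> \<triangleright>\<^bsub>C\<^esub> v = \<alpha> \<star>\<^bsub>C\<^esub> id2 C v"

text \<open>
  For \<open>\<alpha> : g \<odot> f \<Rightarrow> g' \<odot> f'\<close>, the whiskering of \<open>\<alpha>\<close> by \<open>z\<close> re-bracketed to a 2-cell
  \<open>g \<odot> (f \<odot> z) \<Rightarrow> g' \<odot> (f' \<odot> z)\<close>.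
\<close>

definition rwhisker_assoc ::
    "('o, 'm, 'c) bicat \<Rightarrow> 'm \<Rightarrow> 'm \<Rightarrow> 'm \<Rightarrow> 'm \<Rightarrow> 'c \<Rightarrow> 'm \<Rightarrow> 'c" where
  "rwhisker_assoc C g f g' f' \<alpha> z =
     assoc C g' f' z \<bullet>\<^bsub>C\<^esub> (\<alpha> \<triangleright>\<^bsub>C\<^esub> z) \<bullet>\<^bsub>C\<^esub> inv2 C (assoc C g f z)"


section \<open>Pronk's axioms for bicategories of fractions\<close>

text \<open>The triples \<open>(D, v, \<beta>)\<close> sought in axiom BF4a, for \<open>f1, f2\<close> with source \<open>X\<close>:\<close>

definition BF4_triples ::
    "('o, 'm, 'c) bicat \<Rightarrow> 'm set \<Rightarrow> 'o \<Rightarrow> 'm \<Rightarrow> 'm \<Rightarrow> 'm \<Rightarrow> 'c \<Rightarrow> ('o \<times> 'm \<times> 'c) set" where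
  "BF4_triples C W X w f1 f2 \<alpha> =
     {(D, v, \<beta>). v \<in> hom1 C D X \<and> v \<in> W \<and> \<beta> \<in> hom2 C (f1 \<odot>\<^bsub>C\<^esub> v) (f2 \<odot>\<^bsub>C\<^esub> v) \<and>
        rwhisker_assoc C w f1 w f2 \<alpha> v = w \<triangleleft>\<^bsub>C\<^esub> \<beta>}"

text \<open>
  BF4a and BF4b are one axiom here, since the \<open>\<beta>\<close> of BF4b is the one provided by BF4a: for invertible
  \<open>\<alpha>\<close> it can be taken invertible.  This does not ask that all \<open>\<beta>\<close> as in BF4a be invertible.
\<close>

locale BF = bicategory C for C :: "('o, 'm, 'c) bicat" (structure) +
  fixes W :: "'m set"
  assumes W_Mor: "W \<subseteq> Mor C"
    and BF1: "A \<in> Obj C \<Longrightarrow> id1 C A \<in> W"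
    and BF2: "\<lbrakk>f \<in> hom1 C X Y; g \<in> hom1 C Y Z; f \<in> W; g \<in> W\<rbrakk> \<Longrightarrow> g \<odot> f \<in> W"
    and BF3: "\<lbrakk>w \<in> hom1 C A B; w \<in> W; f \<in> hom1 C X B\<rbrakk>
          \<Longrightarrow> \<exists>D w' f' \<alpha>. w' \<in> hom1 C D X \<and> w' \<in> W \<and> f' \<in> hom1 C D A \<and>
                \<alpha> \<in> iso2 C (f \<odot> w') (w \<odot> f')"
    and BF4ab: "\<lbrakk>w \<in> hom1 C B A; w \<in> W; f1 \<in> hom1 C X B; f2 \<in> hom1 C X B;
          \<alpha> \<in> hom2 C (w \<odot> f1) (w \<odot> f2)\<rbrakk>
          \<Longrightarrow> \<exists>D v \<beta>. (D, v, \<beta>) \<in> BF4_triples C W X w f1 f2 \<alpha> \<and>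
                (\<alpha> \<in> iso2 C (w \<odot> f1) (w \<odot> f2) \<longrightarrow> \<beta> \<in> iso2 C (f1 \<odot> v) (f2 \<odot> v))"
    and BF4c: "\<lbrakk>w \<in> hom1 C B A; w \<in> W; f1 \<in> hom1 C X B; f2 \<in> hom1 C X B;
          \<alpha> \<in> hom2 C (w \<odot> f1) (w \<odot> f2);
          (D, v, \<beta>) \<in> BF4_triples C W X w f1 f2 \<alpha>;
          (D', v', \<beta>') \<in> BF4_triples C W X w f1 f2 \<alpha>\<rbrakk>
          \<Longrightarrow> \<exists>E u u' \<zeta>. u \<in> hom1 C E D \<and> u' \<in> hom1 C E D' \<and>
                \<zeta> \<in> iso2 C (v \<odot> u) (v' \<odot> u') \<and> v \<odot> u \<in> W \<and>
                rwhisker_assoc C f1 v' f2 v' \<beta>' u' \<bullet> (f1 \<triangleleft> \<zeta>)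
                  = (f2 \<triangleleft> \<zeta>) \<bullet> rwhisker_assoc C f1 v f2 v \<beta> u"
    and BF5: "\<lbrakk>w \<in> hom1 C A B; w \<in> W; v \<in> hom1 C A B; \<alpha> \<in> iso2 C v w\<rbrakk> \<Longrightarrow> v \<in> W"


section \<open>Morphisms and 2-morphisms of the bicategory of fractions\<close>

definition frac_mor :: "('o, 'm, 'c) bicat \<Rightarrow> 'm set \<Rightarrow> 'o \<Rightarrow> 'o \<Rightarrow> ('o \<times> 'm \<times> 'm) set" where
  "frac_mor C W A B = {(A', w, f). w \<in> hom1 C A' A \<and> w \<in> W \<and> f \<in> hom1 C A' B}"

definition frac_rep ::
    "('o, 'm, 'c) bicat \<Rightarrow> 'm set \<Rightarrow> 'o \<times> 'm \<times> 'm \<Rightarrow> 'o \<times> 'm \<times> 'm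
      \<Rightarrow> ('o \<times> 'm \<times> 'm \<times> 'c \<times> 'c) set" where
  "frac_rep C W = (\<lambda>(A1, w1, f1) (A2, w2, f2).
     {(A3, v1, v2, \<alpha>, \<beta>).
        v1 \<in> hom1 C A3 A1 \<and> v2 \<in> hom1 C A3 A2 \<and> w1 \<odot>\<^bsub>C\<^esub> v1 \<in> W \<and>
        \<alpha> \<in> iso2 C (w1 \<odot>\<^bsub>C\<^esub> v1) (w2 \<odot>\<^bsub>C\<^esub> v2) \<and> \<beta> \<in> hom2 C (f1 \<odot>\<^bsub>C\<^esub> v1) (f2 \<odot>\<^bsub>C\<^esub> v2)})"

text \<open>
  The condition \<open>w1 \<odot> v1 \<odot> z \<in> W\<close> does not depend on the bracketing, by BF5.
\<close>

definition frac_rel ::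
    "('o, 'm, 'c) bicat \<Rightarrow> 'm set \<Rightarrow> 'o \<times> 'm \<times> 'm \<Rightarrow> 'o \<times> 'm \<times> 'm
      \<Rightarrow> ('o \<times> 'm \<times> 'm \<times> 'c \<times> 'c) rel" where
  "frac_rel C W = (\<lambda>(A1, w1, f1) (A2, w2, f2).
     {((A3, v1, v2, \<alpha>, \<beta>), (A3', v1', v2', \<alpha>', \<beta>')).
        (A3, v1, v2, \<alpha>, \<beta>) \<in> frac_rep C W (A1, w1, f1) (A2, w2, f2) \<and>
        (A3', v1', v2', \<alpha>', \<beta>') \<in> frac_rep C W (A1, w1, f1) (A2, w2, f2) \<and>
        (\<exists>A4 z z' \<sigma>1 \<sigma>2.
           z \<in> hom1 C A4 A3 \<and> z' \<in> hom1 C A4 A3' \<and>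
           \<sigma>1 \<in> iso2 C (v1' \<odot>\<^bsub>C\<^esub> z') (v1 \<odot>\<^bsub>C\<^esub> z) \<and> \<sigma>2 \<in> iso2 C (v2 \<odot>\<^bsub>C\<^esub> z) (v2' \<odot>\<^bsub>C\<^esub> z') \<and>
           (w1 \<odot>\<^bsub>C\<^esub> v1) \<odot>\<^bsub>C\<^esub> z \<in> W \<and>
           (w2 \<triangleleft>\<^bsub>C\<^esub> \<sigma>2) \<bullet>\<^bsub>C\<^esub> rwhisker_assoc C w1 v1 w2 v2 \<alpha> z \<bullet>\<^bsub>C\<^esub> (w1 \<triangleleft>\<^bsub>C\<^esub> \<sigma>1)
             = rwhisker_assoc C w1 v1' w2 v2' \<alpha>' z' \<and>
           (f2 \<triangleleft>\<^bsub>C\<^esub> \<sigma>2) \<bullet>\<^bsub>C\<^esub> rwhisker_assoc C f1 v1 f2 v2 \<beta> z \<bullet>\<^bsub>C\<^esub> (f1 \<triangleleft>\<^bsub>C\<^esub> \<sigma>1)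
             = rwhisker_assoc C f1 v1' f2 v2' \<beta>' z')})"

definition frac_cell ::
    "('o, 'm, 'c) bicat \<Rightarrow> 'm set \<Rightarrow> 'o \<times> 'm \<times> 'm \<Rightarrow> 'o \<times> 'm \<times> 'm
      \<Rightarrow> ('o \<times> 'm \<times> 'm \<times> 'c \<times> 'c) set set" where
  "frac_cell C W F1 F2 = frac_rep C W F1 F2 // frac_rel C W F1 F2"

definition frac_class ::
    "('o, 'm, 'c) bicat \<Rightarrow> 'm set \<Rightarrow> 'o \<times> 'm \<times> 'm \<Rightarrow> 'o \<times> 'm \<times> 'm
      \<Rightarrow> 'o \<times> 'm \<times> 'm \<times> 'c \<times> 'c \<Rightarrow> ('o \<times> 'm \<times> 'm \<times> 'c \<times> 'c) set" where
  "frac_class C W F1 F2 d = frac_rel C W F1 F2 `` {d}"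

end

theory Submission
  imports Defs
begin

text \<open>
  Representatives \<open>(v1, v2, \<alpha>, \<beta>)\<close> over a fixed object form a groupoid, whose isomorphisms are pairs
  \<open>v1 \<cong> v1'\<close>, \<open>v2 \<cong> v2'\<close> compatible with \<open>\<alpha>\<close> and \<open>\<beta>\<close>, and they can be restricted along 1-cells \<open>z\<close>,
  pseudofunctorially in \<open>z\<close>.  Two representatives are equivalent iff some restrictions of them are
  isomorphic.  Axioms BF3 and BF4 complete \<open>v1\<close>, \<open>v1'\<close> with \<open>w1 \<odot> v1 \<in> W\<close> to a square up to
  isomorphism, which makes the relation transitive and gives two 2-morphisms a common \<open>v1\<close>; local
  fullness of \<open>w2\<close> then gives a common \<open>v2\<close> and \<open>\<alpha>\<close>.
\<close>

section \<open>Calculus of 2-cells\<close>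

text \<open>Two obstacles shape the argument. The first is that \<open>W\<close> is not assumed to
  satisfy two-out-of-three: \<open>w1 \<odot> v1\<close> may lie in \<open>W\<close> while
  \<open>v1\<close> does not, so BF3 and BF4 cannot be applied to \<open>v1\<close>. They are
  applied to \<open>w1 \<odot> v1\<close>, and the surplus \<open>w1\<close> is stripped by
  restricting once more; likewise a right factor is brought into \<open>W\<close> only after
  precomposition. Every construction therefore refines the source object several times, and all data
  must survive such refinements. The second is that the bicategory is not strict, so each refinement
  changes bracketings. The rebracketing is concentrated in \<open>rwhisker_assoc\<close>, and the
  pentagon enters in a single lemma, which compares rebracketing before and after a restriction.
  Equations that conjugate by isomorphisms are recast as commuting squares, so that composing
  comparisons is pasting.\<close>

context bicategory
begin

lemma comp1_simps:
  assumes "f \<in> Mor C" "g \<in> Mor C" "trg C f = src C g"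
  shows "g \<odot> f \<in> Mor C" "src C (g \<odot> f) = src C f" "trg C (g \<odot> f) = trg C g"
  using comp1_hom[of f "src C f" "trg C f" g "trg C g"] assms by (auto simp: hom1_def)

lemma id2_simps:
  assumes "f \<in> Mor C"
  shows "id2 C f \<in> Cell C" "dom2 C (id2 C f) = f" "cod2 C (id2 C f) = f"
  using id2_hom[OF assms] by (auto simp: hom2_def)

lemma vcomp_simps:
  assumes "\<alpha> \<in> Cell C" "\<beta> \<in> Cell C" "cod2 C \<alpha> = dom2 C \<beta>"
  shows "\<beta> \<bullet> \<alpha> \<in> Cell C" "dom2 C (\<beta> \<bullet> \<alpha>) = dom2 C \<alpha>" "cod2 C (\<beta> \<bullet> \<alpha>) = cod2 C \<beta>"
  using vcomp_hom[of \<alpha> "dom2 C \<alpha>" "cod2 C \<alpha>" \<beta> "cod2 C \<beta>"] assms by (auto simp: hom2_def)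

lemma hcomp_simps:
  assumes "\<alpha> \<in> Cell C" "\<beta> \<in> Cell C" "trg C (dom2 C \<alpha>) = src C (dom2 C \<beta>)"
  shows "\<beta> \<star> \<alpha> \<in> Cell C" "dom2 C (\<beta> \<star> \<alpha>) = dom2 C \<beta> \<odot> dom2 C \<alpha>"
    "cod2 C (\<beta> \<star> \<alpha>) = cod2 C \<beta> \<odot> cod2 C \<alpha>"
  using hcomp_hom[of "dom2 C \<alpha>" "src C (dom2 C \<alpha>)" "trg C (dom2 C \<alpha>)" "dom2 C \<beta>"
      "trg C (dom2 C \<beta>)" \<alpha> "cod2 C \<alpha>" \<beta> "cod2 C \<beta>"] assms
  by (auto simp: hom1_def hom2_def dom2_Mor)

text \<open>A left and a right inverse of the same 2-cell coincide, so the definite description in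
  \<open>inv2\<close> denotes the inverse.\<close>

lemma inv2_simps:
  assumes "\<alpha> \<in> iso2 C f g"
  shows "\<alpha> \<in> Cell C" "dom2 C \<alpha> = f" "cod2 C \<alpha> = g"
    and "inv2 C \<alpha> \<in> Cell C" "dom2 C (inv2 C \<alpha>) = g" "cod2 C (inv2 C \<alpha>) = f"
    and "inv2 C \<alpha> \<bullet> \<alpha> = id2 C f" "\<alpha> \<bullet> inv2 C \<alpha> = id2 C g"
proof -
  obtain \<beta> where \<alpha>: "\<alpha> \<in> hom2 C f g" and \<beta>: "is_inverse2 C \<alpha> \<beta>"
    using assms by (auto simp: iso2_def)
  have "\<gamma> = \<beta>" if "is_inverse2 C \<alpha> \<gamma>" for \<gamma>
  proof -
    have h: "\<beta> \<in> hom2 C g f" "\<gamma> \<in> hom2 C g f" "\<alpha> \<bullet> \<beta> = id2 C g" "\<gamma> \<bullet> \<alpha> = id2 C f"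
      using \<alpha> \<beta> that by (auto simp: is_inverse2_def hom2_def)
    have "\<gamma> = \<gamma> \<bullet> (\<alpha> \<bullet> \<beta>)" using h vcomp_id_right by simp
    also have "\<dots> = (\<gamma> \<bullet> \<alpha>) \<bullet> \<beta>" using h \<alpha> vcomp_assoc by metis
    also have "\<dots> = \<beta>" using h vcomp_id_left by simp
    finally show ?thesis .
  qed
  then have "inv2 C \<alpha> = \<beta>" unfolding inv2_def using \<beta> by blast
  then show "\<alpha> \<in> Cell C" "dom2 C \<alpha> = f" "cod2 C \<alpha> = g"
    "inv2 C \<alpha> \<in> Cell C" "dom2 C (inv2 C \<alpha>) = g" "cod2 C (inv2 C \<alpha>) = f"
    "inv2 C \<alpha> \<bullet> \<alpha> = id2 C f" "\<alpha> \<bullet> inv2 C \<alpha> = id2 C g"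
    using \<alpha> \<beta> by (auto simp: is_inverse2_def hom2_def)
qed

lemma iso2I:
  assumes "\<alpha> \<in> hom2 C f g" "\<beta> \<in> hom2 C g f" "\<beta> \<bullet> \<alpha> = id2 C f" "\<alpha> \<bullet> \<beta> = id2 C g"
  shows "\<alpha> \<in> iso2 C f g"
  using assms by (auto simp: iso2_def is_inverse2_def hom2_def)

lemma inv2_iso: "\<alpha> \<in> iso2 C f g \<Longrightarrow> inv2 C \<alpha> \<in> iso2 C g f"
  by (rule iso2I[where \<beta> = \<alpha>]) (auto simp: inv2_simps hom2_def)

lemma iso2_hom2: "\<alpha> \<in> iso2 C f g \<Longrightarrow> \<alpha> \<in> hom2 C f g"
  by (simp add: iso2_def)

lemma vcomp_id:
  assumes "\<alpha> \<in> Cell C"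
  shows "cod2 C \<alpha> = f \<Longrightarrow> id2 C f \<bullet> \<alpha> = \<alpha>" "dom2 C \<alpha> = f \<Longrightarrow> \<alpha> \<bullet> id2 C f = \<alpha>"
  using assms vcomp_id_left vcomp_id_right by (auto simp: hom2_def)

lemma vcomp_ac:
  assumes "\<alpha> \<in> Cell C" "\<beta> \<in> Cell C" "\<gamma> \<in> Cell C" "cod2 C \<alpha> = dom2 C \<beta>" "cod2 C \<beta> = dom2 C \<gamma>"
  shows "(\<gamma> \<bullet> \<beta>) \<bullet> \<alpha> = \<gamma> \<bullet> (\<beta> \<bullet> \<alpha>)"
  using assms vcomp_assoc[of \<alpha> "dom2 C \<alpha>" "cod2 C \<alpha>" \<beta> "cod2 C \<beta>" \<gamma> "cod2 C \<gamma>"]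
  by (auto simp: hom2_def)

lemma inv2_cancel:
  assumes "\<alpha> \<in> iso2 C f g"
  shows "\<lbrakk>\<beta> \<in> Cell C; cod2 C \<beta> = f\<rbrakk> \<Longrightarrow> inv2 C \<alpha> \<bullet> \<alpha> \<bullet> \<beta> = \<beta>"
    and "\<lbrakk>\<beta> \<in> Cell C; cod2 C \<beta> = g\<rbrakk> \<Longrightarrow> \<alpha> \<bullet> inv2 C \<alpha> \<bullet> \<beta> = \<beta>"
  using inv2_simps[OF assms] by (simp_all add: vcomp_ac[symmetric] vcomp_id)

lemma iso2_cancel_right:
  assumes "\<alpha> \<in> iso2 C f g" "\<beta> \<in> Cell C" "\<gamma> \<in> Cell C" "dom2 C \<beta> = g" "dom2 C \<gamma> = g"
    and "\<beta> \<bullet> \<alpha> = \<gamma> \<bullet> \<alpha>"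
  shows "\<beta> = \<gamma>"
proof -
  have "(\<beta> \<bullet> \<alpha>) \<bullet> inv2 C \<alpha> = (\<gamma> \<bullet> \<alpha>) \<bullet> inv2 C \<alpha>" using assms by simp
  then show ?thesis
    using assms(2-5) inv2_simps[OF assms(1)] by (simp add: vcomp_ac vcomp_id)
qed

lemma hcomp_vcomp:
  assumes "\<alpha> \<in> Cell C" "\<alpha>' \<in> Cell C" "\<beta> \<in> Cell C" "\<beta>' \<in> Cell C" "cod2 C \<alpha> = dom2 C \<alpha>'"
    "cod2 C \<beta> = dom2 C \<beta>'" "trg C (dom2 C \<alpha>) = src C (dom2 C \<beta>)"
  shows "(\<beta>' \<bullet> \<beta>) \<star> (\<alpha>' \<bullet> \<alpha>) = (\<beta>' \<star> \<alpha>') \<bullet> (\<beta> \<star> \<alpha>)"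
  using assms interchange[of "dom2 C \<alpha>" "src C (dom2 C \<alpha>)" "trg C (dom2 C \<alpha>)" "dom2 C \<beta>"
      "trg C (dom2 C \<beta>)" \<alpha> "cod2 C \<alpha>" \<alpha>' "cod2 C \<alpha>'" \<beta> "cod2 C \<beta>" \<beta>' "cod2 C \<beta>'"]
  by (auto simp: hom1_def hom2_def dom2_Mor)

lemma assoc_iso':
  assumes "f \<in> Mor C" "g \<in> Mor C" "h \<in> Mor C" "trg C f = src C g" "trg C g = src C h"
  shows "assoc C h g f \<in> iso2 C ((h \<odot> g) \<odot> f) (h \<odot> (g \<odot> f))"
  by (rule assoc_iso) (use assms in \<open>auto simp: hom1_def\<close>)

lemmas assoc_simps = inv2_simps[OF assoc_iso'] inv2_cancel[OF assoc_iso']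

lemma assoc_natural':
  assumes "\<alpha> \<in> Cell C" "\<beta> \<in> Cell C" "\<gamma> \<in> Cell C"
    and "trg C (dom2 C \<alpha>) = src C (dom2 C \<beta>)" "trg C (dom2 C \<beta>) = src C (dom2 C \<gamma>)"
  shows "assoc C (cod2 C \<gamma>) (cod2 C \<beta>) (cod2 C \<alpha>) \<bullet> ((\<gamma> \<star> \<beta>) \<star> \<alpha>)
    = (\<gamma> \<star> (\<beta> \<star> \<alpha>)) \<bullet> assoc C (dom2 C \<gamma>) (dom2 C \<beta>) (dom2 C \<alpha>)"
  by (rule assoc_natural) (use assms in \<open>auto simp: hom1_def hom2_def dom2_Mor\<close>)

text \<open>As rewrite rules these discharge composability conditions by computing sources, targets,
  domains and codomains, and bring vertical composites to right-nested form, where an associator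
  next to its inverse cancels.\<close>

lemmas cell_simps = comp1_simps id2_simps vcomp_simps hcomp_simps assoc_simps vcomp_id vcomp_ac
  hom1_def hom2_def

section \<open>Whiskering: functoriality, exchange and invertibility\<close>

lemma whisker_hom2:
  assumes "f \<in> hom1 C X Y" "g \<in> hom1 C Y Z"
  shows "\<alpha> \<in> hom2 C f f' \<Longrightarrow> g \<triangleleft> \<alpha> \<in> hom2 C (g \<odot> f) (g \<odot> f')"
    and "\<beta> \<in> hom2 C g g' \<Longrightarrow> \<beta> \<triangleright> f \<in> hom2 C (g \<odot> f) (g' \<odot> f)"
  using assms by (auto simp: lwhisker_def rwhisker_def cell_simps)

lemma lwhisker_vcomp:
  assumes "f \<in> hom1 C X Y" "g \<in> hom1 C Y Z" "\<alpha> \<in> hom2 C f f'" "\<alpha>' \<in> hom2 C f' f''"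
  shows "g \<triangleleft> (\<alpha>' \<bullet> \<alpha>) = (g \<triangleleft> \<alpha>') \<bullet> (g \<triangleleft> \<alpha>)"
  using assms hcomp_vcomp[of \<alpha> \<alpha>' "id2 C g" "id2 C g"] by (simp add: lwhisker_def cell_simps)

lemma rwhisker_vcomp:
  assumes "f \<in> hom1 C X Y" "g \<in> hom1 C Y Z" "\<alpha> \<in> hom2 C g g'" "\<alpha>' \<in> hom2 C g' g''"
  shows "(\<alpha>' \<bullet> \<alpha>) \<triangleright> f = (\<alpha>' \<triangleright> f) \<bullet> (\<alpha> \<triangleright> f)"
  using assms hcomp_vcomp[of "id2 C f" "id2 C f" \<alpha> \<alpha>'] by (simp add: rwhisker_def cell_simps)

text \<open>By interchange and the unit laws both sides are the horizontal composite
  \<open>\<beta> \<star> \<alpha>\<close>.\<close>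

lemma whisker_exchange:
  assumes "f \<in> hom1 C X Y" "g \<in> hom1 C Y Z" "\<alpha> \<in> hom2 C f f'" "\<beta> \<in> hom2 C g g'"
  shows "(g' \<triangleleft> \<alpha>) \<bullet> (\<beta> \<triangleright> f) = (\<beta> \<triangleright> f') \<bullet> (g \<triangleleft> \<alpha>)"
proof -
  have "f' \<in> Mor C" "g' \<in> Mor C"
    using assms dom2_Mor cod2_Mor by (auto simp: hom2_def)
  then show ?thesis
    using assms hcomp_vcomp[of "id2 C f" \<alpha> \<beta> "id2 C g'"] hcomp_vcomp[of \<alpha> "id2 C f'" "id2 C g" \<beta>]
    by (simp add: lwhisker_def rwhisker_def cell_simps)
qed

lemma hom2_hom1:
  assumes "\<alpha> \<in> hom2 C f g"
  shows "f \<in> hom1 C X Y \<Longrightarrow> g \<in> hom1 C X Y" "g \<in> hom1 C X Y \<Longrightarrow> f \<in> hom1 C X Y"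
  using assms src_parallel[of \<alpha>] trg_parallel[of \<alpha>] dom2_Mor[of \<alpha>] cod2_Mor[of \<alpha>]
  by (auto simp: hom1_def hom2_def)

lemma lwhisker_id2:
  assumes "f \<in> hom1 C X Y" "g \<in> hom1 C Y Z"
  shows "g \<triangleleft> id2 C f = id2 C (g \<odot> f)"
  using assms by (simp add: lwhisker_def hcomp_id2)

lemma rwhisker_id2:
  assumes "f \<in> hom1 C X Y" "g \<in> hom1 C Y Z"
  shows "id2 C g \<triangleright> f = id2 C (g \<odot> f)"
  using assms by (simp add: rwhisker_def hcomp_id2)

lemma lwhisker_iso:
  assumes "f \<in> hom1 C X Y" "g \<in> hom1 C Y Z" "\<alpha> \<in> iso2 C f f'"
  shows "g \<triangleleft> \<alpha> \<in> iso2 C (g \<odot> f) (g \<odot> f')"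
    and "(g \<triangleleft> inv2 C \<alpha>) \<bullet> (g \<triangleleft> \<alpha>) = id2 C (g \<odot> f)"
    and "(g \<triangleleft> \<alpha>) \<bullet> (g \<triangleleft> inv2 C \<alpha>) = id2 C (g \<odot> f')"
proof -
  have \<alpha>: "\<alpha> \<in> hom2 C f f'" "inv2 C \<alpha> \<in> hom2 C f' f"
    using assms(3) inv2_iso iso2_hom2 by blast+
  have f': "f' \<in> hom1 C X Y" using hom2_hom1 \<alpha> assms by blast
  show a: "(g \<triangleleft> inv2 C \<alpha>) \<bullet> (g \<triangleleft> \<alpha>) = id2 C (g \<odot> f)"
    and b: "(g \<triangleleft> \<alpha>) \<bullet> (g \<triangleleft> inv2 C \<alpha>) = id2 C (g \<odot> f')"
    using lwhisker_vcomp[OF assms(1,2) \<alpha>] lwhisker_vcomp[OF f' assms(2) \<alpha>(2,1)] assms f'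
    by (simp_all add: inv2_simps[OF assms(3)] lwhisker_id2)
  show "g \<triangleleft> \<alpha> \<in> iso2 C (g \<odot> f) (g \<odot> f')"
    by (rule iso2I[OF _ _ a b]) (use \<alpha> assms f' whisker_hom2 in blast)+
qed

lemma rwhisker_iso:
  assumes "f \<in> hom1 C X Y" "g \<in> hom1 C Y Z" "\<alpha> \<in> iso2 C g g'"
  shows "\<alpha> \<triangleright> f \<in> iso2 C (g \<odot> f) (g' \<odot> f)"
proof -
  have \<alpha>: "\<alpha> \<in> hom2 C g g'" "inv2 C \<alpha> \<in> hom2 C g' g"
    using assms(3) inv2_iso iso2_hom2 by blast+
  have g': "g' \<in> hom1 C Y Z" using hom2_hom1 \<alpha> assms by blast
  have a: "(inv2 C \<alpha> \<triangleright> f) \<bullet> (\<alpha> \<triangleright> f) = id2 C (g \<odot> f)"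
    and b: "(\<alpha> \<triangleright> f) \<bullet> (inv2 C \<alpha> \<triangleright> f) = id2 C (g' \<odot> f)"
    using rwhisker_vcomp[OF assms(1,2) \<alpha>] rwhisker_vcomp[OF assms(1) g' \<alpha>(2,1)] assms g'
    by (simp_all add: inv2_simps[OF assms(3)] rwhisker_id2)
  show ?thesis
    by (rule iso2I[OF _ _ a b]) (use \<alpha> assms g' whisker_hom2 in blast)+
qed

lemma vcomp_iso:
  assumes "\<alpha> \<in> iso2 C f g" "\<beta> \<in> iso2 C g h"
  shows "\<beta> \<bullet> \<alpha> \<in> iso2 C f h"
proof (rule iso2I)
  note s = inv2_simps[OF assms(1)] inv2_simps[OF assms(2)] inv2_cancel[OF assms(1)]
    inv2_cancel[OF assms(2)]
  show "\<beta> \<bullet> \<alpha> \<in> hom2 C f h" "inv2 C \<alpha> \<bullet> inv2 C \<beta> \<in> hom2 C h f"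
    "(inv2 C \<alpha> \<bullet> inv2 C \<beta>) \<bullet> \<beta> \<bullet> \<alpha> = id2 C f" "(\<beta> \<bullet> \<alpha>) \<bullet> inv2 C \<alpha> \<bullet> inv2 C \<beta> = id2 C h"
    by (simp_all add: cell_simps s)
qed

lemma id2_iso: "f \<in> Mor C \<Longrightarrow> id2 C f \<in> iso2 C f f"
  by (rule iso2I[where \<beta> = "id2 C f"]) (simp_all add: cell_simps)

section \<open>Restriction of 2-cells along 1-cells, with rebracketing\<close>

abbreviation rw where "rw \<equiv> rwhisker_assoc C"

lemma rw_hom2:
  assumes "z \<in> hom1 C V X" "f \<in> hom1 C X Y" "g \<in> hom1 C Y Z" "f' \<in> hom1 C X Y'" "g' \<in> hom1 C Y' Z"
    and "\<alpha> \<in> hom2 C (g \<odot> f) (g' \<odot> f')"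
  shows "rw g f g' f' \<alpha> z \<in> hom2 C (g \<odot> (f \<odot> z)) (g' \<odot> (f' \<odot> z))"
  using assms by (auto simp: rwhisker_assoc_def rwhisker_def cell_simps)

lemma rw_vcomp:
  assumes "z \<in> hom1 C V X" "f \<in> hom1 C X Y" "g \<in> hom1 C Y Z" "f' \<in> hom1 C X Y'" "g' \<in> hom1 C Y' Z"
    and "f'' \<in> hom1 C X Y''" "g'' \<in> hom1 C Y'' Z"
    and "\<alpha> \<in> hom2 C (g \<odot> f) (g' \<odot> f')" "\<beta> \<in> hom2 C (g' \<odot> f') (g'' \<odot> f'')"
  shows "rw g f g'' f'' (\<beta> \<bullet> \<alpha>) z = rw g' f' g'' f'' \<beta> z \<bullet> rw g f g' f' \<alpha> z"
proof -
  have "(\<beta> \<bullet> \<alpha>) \<triangleright> z = (\<beta> \<triangleright> z) \<bullet> (\<alpha> \<triangleright> z)"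
    by (rule rwhisker_vcomp[where X = V and Y = X and Z = Z]) (use assms comp1_hom in auto)
  then show ?thesis
    using assms by (simp add: rwhisker_assoc_def rwhisker_def cell_simps)
qed

lemma rw_id2:
  assumes "z \<in> hom1 C V X" "f \<in> hom1 C X Y" "g \<in> hom1 C Y Z"
  shows "rw g f g f (id2 C (g \<odot> f)) z = id2 C (g \<odot> (f \<odot> z))"
  using assms comp1_hom[OF assms(2,3)]
  by (simp add: rwhisker_assoc_def rwhisker_id2) (simp add: cell_simps)

lemma rw_iso:
  assumes "z \<in> hom1 C V X" "f \<in> hom1 C X Y" "g \<in> hom1 C Y Z" "f' \<in> hom1 C X Y'" "g' \<in> hom1 C Y' Z"
    and "\<alpha> \<in> iso2 C (g \<odot> f) (g' \<odot> f')"
  shows "rw g f g' f' \<alpha> z \<in> iso2 C (g \<odot> (f \<odot> z)) (g' \<odot> (f' \<odot> z))"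
proof (rule iso2I)
  have \<alpha>: "\<alpha> \<in> hom2 C (g \<odot> f) (g' \<odot> f')" "inv2 C \<alpha> \<in> hom2 C (g' \<odot> f') (g \<odot> f)"
    using assms(6) inv2_iso iso2_hom2 by blast+
  show "rw g f g' f' \<alpha> z \<in> hom2 C (g \<odot> (f \<odot> z)) (g' \<odot> (f' \<odot> z))"
    "rw g' f' g f (inv2 C \<alpha>) z \<in> hom2 C (g' \<odot> (f' \<odot> z)) (g \<odot> (f \<odot> z))"
    using assms \<alpha> rw_hom2 by blast+
  show "rw g' f' g f (inv2 C \<alpha>) z \<bullet> rw g f g' f' \<alpha> z = id2 C (g \<odot> (f \<odot> z))"
    "rw g f g' f' \<alpha> z \<bullet> rw g' f' g f (inv2 C \<alpha>) z = id2 C (g' \<odot> (f' \<odot> z))"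
    using rw_vcomp[OF assms(1-5,2,3) \<alpha>] rw_vcomp[OF assms(1,4,5,2,3,4,5) \<alpha>(2,1)]
    by (simp_all add: inv2_simps[OF assms(6)] rw_id2[OF assms(1-3)] rw_id2[OF assms(1,4,5)])
qed

text \<open>Naturality of the associator in its middle argument.\<close>

lemma rw_lwhisker:
  assumes "z \<in> hom1 C V X" "f \<in> hom1 C X Y" "g \<in> hom1 C Y Z" "\<sigma> \<in> hom2 C f f'"
  shows "rw g f g f' (g \<triangleleft> \<sigma>) z = g \<triangleleft> (\<sigma> \<triangleright> z)"
proof -
  have f': "f' \<in> hom1 C X Y" using assms hom2_hom1 by blast
  have "assoc C g f' z \<bullet> ((g \<triangleleft> \<sigma>) \<triangleright> z) = (g \<triangleleft> (\<sigma> \<triangleright> z)) \<bullet> assoc C g f z"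
    using assms f' assoc_natural'[of "id2 C z" \<sigma> "id2 C g"]
    by (simp add: lwhisker_def rwhisker_def cell_simps)
  then have "(assoc C g f' z \<bullet> ((g \<triangleleft> \<sigma>) \<triangleright> z)) \<bullet> inv2 C (assoc C g f z)
      = ((g \<triangleleft> (\<sigma> \<triangleright> z)) \<bullet> assoc C g f z) \<bullet> inv2 C (assoc C g f z)"
    by simp
  then show ?thesis
    using assms f' by (simp add: rwhisker_assoc_def lwhisker_def rwhisker_def cell_simps)
qed

text \<open>Naturality of the associator in its last argument, with
  \<open>id2 C g \<star> id2 C f\<close> contracted to the identity of the composite.\<close>

lemma assoc_lwhisker:
  assumes "z \<in> hom1 C V X" "f \<in> hom1 C X Y" "g \<in> hom1 C Y Z" "\<tau> \<in> hom2 C z z'"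
  shows "assoc C g f z' \<bullet> ((g \<odot> f) \<triangleleft> \<tau>) = (g \<triangleleft> (f \<triangleleft> \<tau>)) \<bullet> assoc C g f z"
proof -
  have "z' \<in> hom1 C V X" using assms hom2_hom1 by blast
  then show ?thesis
    using assms assoc_natural'[of \<tau> "id2 C f" "id2 C g"] hcomp_id2[OF assms(2,3)]
    by (simp add: lwhisker_def cell_simps)
qed

text \<open>Exchange moves \<tau> past \<open>\<alpha> \<triangleright> z\<close>, and
  \<open>assoc_lwhisker\<close> moves it past the associators on either side. Restrictions along
  isomorphic 1-cells are thereby comparable.\<close>

lemma rw_natural:
  assumes "z \<in> hom1 C V X" "f \<in> hom1 C X Y" "g \<in> hom1 C Y Z" "f' \<in> hom1 C X Y'" "g' \<in> hom1 C Y' Z"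
    and "\<alpha> \<in> hom2 C (g \<odot> f) (g' \<odot> f')" "\<tau> \<in> hom2 C z z'"
  shows "(g' \<triangleleft> (f' \<triangleleft> \<tau>)) \<bullet> rw g f g' f' \<alpha> z = rw g f g' f' \<alpha> z' \<bullet> (g \<triangleleft> (f \<triangleleft> \<tau>))"
proof -
  have z': "z' \<in> hom1 C V X" using assms hom2_hom1 by blast
  have nat: "assoc C k h z' \<bullet> ((k \<odot> h) \<triangleleft> \<tau>) = (k \<triangleleft> (h \<triangleleft> \<tau>)) \<bullet> assoc C k h z"
    if "h \<in> hom1 C X U" "k \<in> hom1 C U Z" for h k U
    using assms that by (intro assoc_lwhisker)
  have "(g' \<triangleleft> (f' \<triangleleft> \<tau>)) \<bullet> rw g f g' f' \<alpha> z
      = ((g' \<triangleleft> (f' \<triangleleft> \<tau>)) \<bullet> assoc C g' f' z) \<bullet> (\<alpha> \<triangleright> z) \<bullet> inv2 C (assoc C g f z)"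
    using assms z' by (simp add: rwhisker_assoc_def lwhisker_def rwhisker_def cell_simps)
  also have "\<dots> = assoc C g' f' z' \<bullet> (((g' \<odot> f') \<triangleleft> \<tau>) \<bullet> (\<alpha> \<triangleright> z)) \<bullet> inv2 C (assoc C g f z)"
    using assms z' unfolding nat[OF assms(4,5), symmetric]
    by (simp add: lwhisker_def rwhisker_def cell_simps)
  also have "((g' \<odot> f') \<triangleleft> \<tau>) \<bullet> (\<alpha> \<triangleright> z) = (\<alpha> \<triangleright> z') \<bullet> ((g \<odot> f) \<triangleleft> \<tau>)"
    by (rule whisker_exchange) (use assms comp1_hom in auto)
  also have "assoc C g' f' z' \<bullet> ((\<alpha> \<triangleright> z') \<bullet> ((g \<odot> f) \<triangleleft> \<tau>)) \<bullet> inv2 C (assoc C g f z)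
      = rw g f g' f' \<alpha> z' \<bullet> (assoc C g f z' \<bullet> ((g \<odot> f) \<triangleleft> \<tau>)) \<bullet> inv2 C (assoc C g f z)"
    using assms z' by (simp add: rwhisker_assoc_def lwhisker_def rwhisker_def cell_simps)
  also have "\<dots> = rw g f g' f' \<alpha> z' \<bullet> (g \<triangleleft> (f \<triangleleft> \<tau>))"
    using assms z' rw_hom2[OF z' assms(2-6)] unfolding nat[OF assms(2,3)]
    by (simp add: lwhisker_def cell_simps)
  finally show ?thesis .
qed

text \<open>The pentagon, used once on the source and once on the target, compares rebracketing
  \<kappa> before and after restricting along \<open>t\<close>. The legs \<open>z\<close> and
  \<open>z'\<close> are kept distinct: \<open>\<kappa> = \<alpha> \<triangleright> z\<close> gives
  \<open>rw_comp1\<close>, but \<open>rel_parallel_imp\<close> needs a \<kappa> between different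
  legs.\<close>

lemma assoc_rw:
  assumes t: "t \<in> hom1 C U V" and z: "z \<in> hom1 C V X" "z' \<in> hom1 C V X'"
    and f: "f \<in> hom1 C X Y" "f' \<in> hom1 C X' Y'" and g: "g \<in> hom1 C Y Z" "g' \<in> hom1 C Y' Z"
    and \<kappa>: "\<kappa> \<in> hom2 C ((g \<odot> f) \<odot> z) ((g' \<odot> f') \<odot> z')"
  shows "(g' \<triangleleft> assoc C f' z' t)
      \<bullet> rw g (f \<odot> z) g' (f' \<odot> z') (assoc C g' f' z' \<bullet> \<kappa> \<bullet> inv2 C (assoc C g f z)) t
    = (assoc C g' f' (z' \<odot> t) \<bullet> rw (g \<odot> f) z (g' \<odot> f') z' \<kappa> t \<bullet> inv2 C (assoc C g f (z \<odot> t)))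
      \<bullet> (g \<triangleleft> assoc C f z t)" (is "?l \<bullet> ?r = ?m \<bullet> ?n")
proof -
  let ?a = "assoc C g f z" and ?a' = "assoc C g' f' z'"
  have pent: "(g \<triangleleft> assoc C f z t) \<bullet> assoc C g (f \<odot> z) t \<bullet> (?a \<triangleright> t)
      = assoc C g f (z \<odot> t) \<bullet> assoc C (g \<odot> f) z t"
    using pentagon[OF t z(1) f(1) g(1)] by (simp add: lwhisker_def rwhisker_def)
  have pent': "(g' \<triangleleft> assoc C f' z' t) \<bullet> assoc C g' (f' \<odot> z') t \<bullet> (?a' \<triangleright> t)
      = assoc C g' f' (z' \<odot> t) \<bullet> assoc C (g' \<odot> f') z' t"
    using pentagon[OF t z(2) f(2) g(2)] by (simp add: lwhisker_def rwhisker_def)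
  have w: "(?a' \<bullet> \<kappa> \<bullet> inv2 C ?a) \<triangleright> t \<bullet> (?a \<triangleright> t) = (?a' \<triangleright> t) \<bullet> (\<kappa> \<triangleright> t)"
  proof -
    have "(?a' \<bullet> \<kappa> \<bullet> inv2 C ?a) \<triangleright> t \<bullet> (?a \<triangleright> t) = ((?a' \<bullet> \<kappa> \<bullet> inv2 C ?a) \<bullet> ?a) \<triangleright> t"
      by (rule rwhisker_vcomp[symmetric]) (use assms in \<open>auto simp: cell_simps\<close>)
    also have "(?a' \<bullet> \<kappa> \<bullet> inv2 C ?a) \<bullet> ?a = ?a' \<bullet> \<kappa>"
      using assms by (simp add: cell_simps)
    also have "(?a' \<bullet> \<kappa>) \<triangleright> t = (?a' \<triangleright> t) \<bullet> (\<kappa> \<triangleright> t)"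
      by (rule rwhisker_vcomp) (use assms in \<open>auto simp: cell_simps\<close>)
    finally show ?thesis .
  qed
  \<comment> \<open>Precomposition with this invertible 2-cell cancels the inverse associators on
    the left and exposes one side of the pentagon on the right.\<close>
  let ?e = "assoc C g (f \<odot> z) t \<bullet> (?a \<triangleright> t)"
  have at: "?a \<triangleright> t \<in> iso2 C (((g \<odot> f) \<odot> z) \<odot> t) ((g \<odot> (f \<odot> z)) \<odot> t)"
    by (rule rwhisker_iso) (use assms in \<open>auto simp: cell_simps intro!: assoc_iso'\<close>)
  have e: "?e \<in> iso2 C (((g \<odot> f) \<odot> z) \<odot> t) (g \<odot> ((f \<odot> z) \<odot> t))"
    by (rule vcomp_iso[OF at]) (use assms in \<open>auto simp: cell_simps intro!: assoc_iso'\<close>)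
  have "(?l \<bullet> ?r) \<bullet> ?e = (?m \<bullet> ?n) \<bullet> ?e"
  proof -
    have "(?l \<bullet> ?r) \<bullet> ?e = ?l \<bullet> assoc C g' (f' \<odot> z') t \<bullet> ((?a' \<bullet> \<kappa> \<bullet> inv2 C ?a) \<triangleright> t \<bullet> (?a \<triangleright> t))"
      using assms by (simp add: rwhisker_assoc_def lwhisker_def rwhisker_def cell_simps)
    also have "\<dots> = (?l \<bullet> assoc C g' (f' \<odot> z') t \<bullet> (?a' \<triangleright> t)) \<bullet> (\<kappa> \<triangleright> t)"
      unfolding w using assms by (simp add: lwhisker_def rwhisker_def cell_simps)
    also have "\<dots> = ?m \<bullet> assoc C g f (z \<odot> t) \<bullet> assoc C (g \<odot> f) z t"
      unfolding pent' using assms by (simp add: rwhisker_assoc_def rwhisker_def cell_simps)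
    also have "\<dots> = (?m \<bullet> ?n) \<bullet> ?e"
      unfolding pent[symmetric] using assms
      by (simp add: rwhisker_assoc_def lwhisker_def rwhisker_def cell_simps)
    finally show ?thesis .
  qed
  then show ?thesis
    by (rule iso2_cancel_right[OF e, rotated -1])
      (use assms in \<open>auto simp: rwhisker_assoc_def lwhisker_def rwhisker_def cell_simps\<close>)
qed

text \<open>Naturality of the associator in its first argument.\<close>

lemma rw_rwhisker:
  assumes "t \<in> hom1 C U V" "z \<in> hom1 C V X" "g \<in> hom1 C X Y" "\<alpha> \<in> hom2 C g g'"
  shows "rw g z g' z (\<alpha> \<triangleright> z) t = \<alpha> \<triangleright> (z \<odot> t)"
proof -
  have g': "g' \<in> hom1 C X Y" using assms hom2_hom1 by blast
  have "assoc C g' z t \<bullet> ((\<alpha> \<triangleright> z) \<triangleright> t) = (\<alpha> \<triangleright> (z \<odot> t)) \<bullet> assoc C g z t"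
    using assms g' assoc_natural'[of "id2 C t" "id2 C z" \<alpha>] hcomp_id2[OF assms(1,2)]
    by (simp add: rwhisker_def cell_simps)
  then have "(assoc C g' z t \<bullet> ((\<alpha> \<triangleright> z) \<triangleright> t)) \<bullet> inv2 C (assoc C g z t)
    = ((\<alpha> \<triangleright> (z \<odot> t)) \<bullet> assoc C g z t) \<bullet> inv2 C (assoc C g z t)" by simp
  then show ?thesis
    using assms g' by (simp add: rwhisker_assoc_def rwhisker_def cell_simps)
qed

text \<open>The case \<open>\<alpha> \<triangleright> z\<close> of \<open>assoc_rw\<close>: the
  associators are the comparison cells that make restriction pseudofunctorial.\<close>

lemma rw_comp1:
  assumes "t \<in> hom1 C U V" "z \<in> hom1 C V X" "f \<in> hom1 C X Y" "f' \<in> hom1 C X Y'"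
    "g \<in> hom1 C Y Z" "g' \<in> hom1 C Y' Z" "\<alpha> \<in> hom2 C (g \<odot> f) (g' \<odot> f')"
  shows "(g' \<triangleleft> assoc C f' z t) \<bullet> rw g (f \<odot> z) g' (f' \<odot> z) (rw g f g' f' \<alpha> z) t
    = rw g f g' f' \<alpha> (z \<odot> t) \<bullet> (g \<triangleleft> assoc C f z t)"
proof -
  have gf: "g \<odot> f \<in> hom1 C X Z" "g' \<odot> f' \<in> hom1 C X Z" using assms comp1_hom by auto
  moreover have "\<alpha> \<triangleright> z \<in> hom2 C ((g \<odot> f) \<odot> z) ((g' \<odot> f') \<odot> z)"
    using assms gf whisker_hom2 by blast
  ultimately show ?thesis
    using assoc_rw[OF assms(1) assms(2,2-6), of "\<alpha> \<triangleright> z"] rw_rwhisker[OF assms(1,2) gf(1) assms(7)]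
    by (simp add: rwhisker_assoc_def)
qed

lemma rw_cancel:
  assumes "z \<in> hom1 C V X" "f \<in> hom1 C X Y" "g \<in> hom1 C Y Z" "f' \<in> hom1 C X Y'" "g' \<in> hom1 C Y' Z"
    and "\<alpha> \<in> hom2 C (g \<odot> f) (g' \<odot> f')" "\<beta> \<in> hom2 C (g \<odot> f) (g' \<odot> f')"
    and "rw g f g' f' \<alpha> z = rw g f g' f' \<beta> z"
  shows "\<alpha> \<triangleright> z = \<beta> \<triangleright> z"
proof -
  let ?a = "assoc C g f z" and ?a' = "assoc C g' f' z"
  have "inv2 C ?a' \<bullet> (?a' \<bullet> (\<alpha> \<triangleright> z) \<bullet> inv2 C ?a) \<bullet> ?a
    = inv2 C ?a' \<bullet> (?a' \<bullet> (\<beta> \<triangleright> z) \<bullet> inv2 C ?a) \<bullet> ?a"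
    using assms(8) by (simp add: rwhisker_assoc_def)
  then show ?thesis using assms(1-7) by (simp add: rwhisker_def cell_simps)
qed

section \<open>Commuting squares of 2-cells with whiskered sides, and their pasting\<close>

definition sq :: "'m \<Rightarrow> 'm \<Rightarrow> 'c \<Rightarrow> 'c \<Rightarrow> 'c \<Rightarrow> 'c \<Rightarrow> bool" where
  "sq g g' \<sigma> \<sigma>' \<alpha> \<beta> \<longleftrightarrow> (g' \<triangleleft> \<sigma>') \<bullet> \<alpha> = \<beta> \<bullet> (g \<triangleleft> \<sigma>)"

lemma sq_refl:
  assumes "f \<in> hom1 C X Y" "g \<in> hom1 C Y Z" "f' \<in> hom1 C X Y'" "g' \<in> hom1 C Y' Z"
    and "\<alpha> \<in> hom2 C (g \<odot> f) (g' \<odot> f')"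
  shows "sq g g' (id2 C f) (id2 C f') \<alpha> \<alpha>"
  using assms by (simp add: sq_def lwhisker_id2) (simp add: cell_simps)

lemma sq_trans:
  assumes "g \<in> hom1 C Y Z" "g' \<in> hom1 C Y' Z" "f \<in> hom1 C X Y" "f' \<in> hom1 C X Y'"
    and "\<alpha> \<in> hom2 C (g \<odot> f) (g' \<odot> f')" "\<beta> \<in> hom2 C (g \<odot> h) (g' \<odot> h')"
    and "\<gamma> \<in> hom2 C (g \<odot> k) (g' \<odot> k')"
    and \<sigma>: "\<sigma> \<in> hom2 C f h" "\<sigma>' \<in> hom2 C f' h'" and \<tau>: "\<tau> \<in> hom2 C h k" "\<tau>' \<in> hom2 C h' k'"
    and sq: "sq g g' \<sigma> \<sigma>' \<alpha> \<beta>" "sq g g' \<tau> \<tau>' \<beta> \<gamma>"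
  shows "sq g g' (\<tau> \<bullet> \<sigma>) (\<tau>' \<bullet> \<sigma>') \<alpha> \<gamma>"
proof -
  have h: "h \<in> hom1 C X Y" "h' \<in> hom1 C X Y'" "k \<in> hom1 C X Y" "k' \<in> hom1 C X Y'"
    using \<sigma> \<tau> assms(3,4) hom2_hom1 by blast+
  have "(g' \<triangleleft> (\<tau>' \<bullet> \<sigma>')) \<bullet> \<alpha> = (g' \<triangleleft> \<tau>') \<bullet> (g' \<triangleleft> \<sigma>') \<bullet> \<alpha>"
    using assms h lwhisker_vcomp[OF assms(4,2) \<sigma>(2) \<tau>(2)] by (simp add: lwhisker_def cell_simps)
  also have "\<dots> = ((g' \<triangleleft> \<tau>') \<bullet> \<beta>) \<bullet> (g \<triangleleft> \<sigma>)"
    using assms(1-11) h sq(1) by (simp add: sq_def lwhisker_def cell_simps)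
  also have "\<dots> = \<gamma> \<bullet> (g \<triangleleft> (\<tau> \<bullet> \<sigma>))"
    using assms(1-11) h sq(2) lwhisker_vcomp[OF assms(3,1) \<sigma>(1) \<tau>(1)]
    by (simp add: sq_def lwhisker_def cell_simps)
  finally show ?thesis by (simp add: sq_def)
qed

lemma sq_sym:
  assumes "g \<in> hom1 C Y Z" "g' \<in> hom1 C Y' Z" "f \<in> hom1 C X Y" "f' \<in> hom1 C X Y'"
    and "\<alpha> \<in> hom2 C (g \<odot> f) (g' \<odot> f')" "\<beta> \<in> hom2 C (g \<odot> h) (g' \<odot> h')"
    and \<sigma>: "\<sigma> \<in> iso2 C f h" "\<sigma>' \<in> iso2 C f' h'"
    and sq: "sq g g' \<sigma> \<sigma>' \<alpha> \<beta>"
  shows "sq g g' (inv2 C \<sigma>) (inv2 C \<sigma>') \<beta> \<alpha>"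
proof -
  have h: "h \<in> hom1 C X Y" "h' \<in> hom1 C X Y'"
    using \<sigma> assms(3,4) hom2_hom1 iso2_hom2 by blast+
  note w = lwhisker_iso[OF assms(3,1) \<sigma>(1)] lwhisker_iso[OF assms(4,2) \<sigma>(2)]
  note types = whisker_hom2(1)[OF h(1) assms(1) iso2_hom2[OF inv2_iso[OF \<sigma>(1)]]]
    whisker_hom2(1)[OF h(2) assms(2) iso2_hom2[OF inv2_iso[OF \<sigma>(2)]]]
    iso2_hom2[OF w(1)] iso2_hom2[OF w(4)]
  have "(g' \<triangleleft> inv2 C \<sigma>') \<bullet> \<beta> = (g' \<triangleleft> inv2 C \<sigma>') \<bullet> \<beta> \<bullet> (g \<triangleleft> \<sigma>) \<bullet> (g \<triangleleft> inv2 C \<sigma>)"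
    using assms(1-6) types w(3) by (simp add: cell_simps)
  also have "\<dots> = (g' \<triangleleft> inv2 C \<sigma>') \<bullet> ((g' \<triangleleft> \<sigma>') \<bullet> \<alpha>) \<bullet> (g \<triangleleft> inv2 C \<sigma>)"
    using assms(1-6) types sq by (simp add: sq_def cell_simps)
  also have "\<dots> = ((g' \<triangleleft> inv2 C \<sigma>') \<bullet> (g' \<triangleleft> \<sigma>')) \<bullet> \<alpha> \<bullet> (g \<triangleleft> inv2 C \<sigma>)"
    using assms(1-6) types by (simp add: cell_simps)
  also have "\<dots> = \<alpha> \<bullet> (g \<triangleleft> inv2 C \<sigma>)"
    using assms(1-6) types w(5) by (simp add: cell_simps)
  finally show ?thesis by (simp add: sq_def)
qed

text \<open>Each side of the square is restricted as a single 2-cell; \<open>rw_vcomp\<close> splits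
  it again and \<open>rw_lwhisker\<close> keeps the comparison sides whiskered.\<close>

lemma sq_rwhisker:
  assumes z: "z \<in> hom1 C V X"
    and g: "g \<in> hom1 C Y Z" "g' \<in> hom1 C Y' Z" and f: "f \<in> hom1 C X Y" "f' \<in> hom1 C X Y'"
    and \<alpha>: "\<alpha> \<in> hom2 C (g \<odot> f) (g' \<odot> f')" "\<beta> \<in> hom2 C (g \<odot> h) (g' \<odot> h')"
    and \<sigma>: "\<sigma> \<in> hom2 C f h" "\<sigma>' \<in> hom2 C f' h'"
    and sq: "sq g g' \<sigma> \<sigma>' \<alpha> \<beta>"
  shows "sq g g' (\<sigma> \<triangleright> z) (\<sigma>' \<triangleright> z) (rw g f g' f' \<alpha> z) (rw g h g' h' \<beta> z)"
proof -
  have h: "h \<in> hom1 C X Y" "h' \<in> hom1 C X Y'" using \<sigma> f hom2_hom1 by blast+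
  have "(g' \<triangleleft> (\<sigma>' \<triangleright> z)) \<bullet> rw g f g' f' \<alpha> z = rw g f g' h' ((g' \<triangleleft> \<sigma>') \<bullet> \<alpha>) z"
    using rw_lwhisker[OF z f(2) g(2) \<sigma>(2)] rw_vcomp[OF z f(1) g(1) f(2) g(2) h(2) g(2) \<alpha>(1)]
      whisker_hom2(1)[OF f(2) g(2) \<sigma>(2)] by simp
  also have "\<dots> = rw g h g' h' \<beta> z \<bullet> (g \<triangleleft> (\<sigma> \<triangleright> z))"
    using rw_lwhisker[OF z f(1) g(1) \<sigma>(1)]
      rw_vcomp[OF z f(1) g(1) h(1) g(1) h(2) g(2) whisker_hom2(1)[OF f(1) g(1) \<sigma>(1)] \<alpha>(2)]
      sq by (simp add: sq_def)
  finally show ?thesis by (simp add: sq_def)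
qed

text \<open>Unfolded, \<open>rw f z h z' \<sigma> t\<close> is an inverse associator, then
  \<open>\<sigma> \<triangleright> t\<close>, then an associator. Each factor has its own square,
  the outer two by \<open>rw_comp1\<close>, and the three are pasted.\<close>

lemma sq_rw:
  assumes t: "t \<in> hom1 C U V" and z: "z \<in> hom1 C V X" "z' \<in> hom1 C V X'"
    and g: "g \<in> hom1 C Y Z" "g' \<in> hom1 C Y' Z"
    and f: "f \<in> hom1 C X Y" "f' \<in> hom1 C X Y'" and h: "h \<in> hom1 C X' Y" "h' \<in> hom1 C X' Y'"
    and \<alpha>: "\<alpha> \<in> hom2 C (g \<odot> f) (g' \<odot> f')" and \<beta>: "\<beta> \<in> hom2 C (g \<odot> h) (g' \<odot> h')"
    and \<sigma>: "\<sigma> \<in> hom2 C (f \<odot> z) (h \<odot> z')" "\<sigma>' \<in> hom2 C (f' \<odot> z) (h' \<odot> z')"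
    and sq: "sq g g' \<sigma> \<sigma>' (rw g f g' f' \<alpha> z) (rw g h g' h' \<beta> z')"
  shows "sq g g' (rw f z h z' \<sigma> t) (rw f' z h' z' \<sigma>' t)
    (rw g f g' f' \<alpha> (z \<odot> t)) (rw g h g' h' \<beta> (z' \<odot> t))"
proof -
  note c = comp1_hom[OF z(1) f(1)] comp1_hom[OF z(1) f(2)] comp1_hom[OF z(2) h(1)]
    comp1_hom[OF z(2) h(2)]
  note zt = comp1_hom[OF t z(1)] comp1_hom[OF t z(2)]
  note R\<alpha> = rw_hom2[OF z(1) f(1) g(1) f(2) g(2) \<alpha>] and R\<beta> = rw_hom2[OF z(2) h(1) g(1) h(2) g(2) \<beta>]
  note a = assoc_iso[OF t z(1) f(1)] assoc_iso[OF t z(1) f(2)] assoc_iso[OF t z(2) h(1)]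
    assoc_iso[OF t z(2) h(2)]
  note ia = iso2_hom2[OF inv2_iso[OF a(1)]] iso2_hom2[OF inv2_iso[OF a(2)]]
  note RR\<alpha> = rw_hom2[OF t c(1) g(1) c(2) g(2) R\<alpha>] and RR\<beta> = rw_hom2[OF t c(3) g(1) c(4) g(2) R\<beta>]
  note Rt\<alpha> = rw_hom2[OF zt(1) f(1) g(1) f(2) g(2) \<alpha>] and Rt\<beta> = rw_hom2[OF zt(2) h(1) g(1) h(2) g(2) \<beta>]
  note w = whisker_hom2(2)[OF t c(1) \<sigma>(1)] whisker_hom2(2)[OF t c(2) \<sigma>(2)]
  have s1: "sq g g' (inv2 C (assoc C f z t)) (inv2 C (assoc C f' z t))
      (rw g f g' f' \<alpha> (z \<odot> t)) (rw g (f \<odot> z) g' (f' \<odot> z) (rw g f g' f' \<alpha> z) t)"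
    using rw_comp1[OF t z(1) f g \<alpha>]
    by (intro sq_sym[OF g comp1_hom[OF t c(1)] comp1_hom[OF t c(2)] RR\<alpha> Rt\<alpha> a(1,2)])
      (simp add: sq_def)
  have s2: "sq g g' (\<sigma> \<triangleright> t) (\<sigma>' \<triangleright> t) (rw g (f \<odot> z) g' (f' \<odot> z) (rw g f g' f' \<alpha> z) t)
      (rw g (h \<odot> z') g' (h' \<odot> z') (rw g h g' h' \<beta> z') t)"
    by (rule sq_rwhisker[OF t g c(1,2) R\<alpha> R\<beta> \<sigma> sq])
  have s3: "sq g g' (assoc C h z' t) (assoc C h' z' t)
      (rw g (h \<odot> z') g' (h' \<odot> z') (rw g h g' h' \<beta> z') t) (rw g h g' h' \<beta> (z' \<odot> t))"
    using rw_comp1[OF t z(2) h g \<beta>] by (simp add: sq_def)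
  note fzt = comp1_hom[OF zt(1) f(1)] comp1_hom[OF zt(1) f(2)]
  have s12: "sq g g' ((\<sigma> \<triangleright> t) \<bullet> inv2 C (assoc C f z t)) ((\<sigma>' \<triangleright> t) \<bullet> inv2 C (assoc C f' z t))
      (rw g f g' f' \<alpha> (z \<odot> t)) (rw g (h \<odot> z') g' (h' \<odot> z') (rw g h g' h' \<beta> z') t)"
    by (rule sq_trans[OF g fzt Rt\<alpha> RR\<alpha> RR\<beta> ia w s1 s2])
  show ?thesis
    unfolding rwhisker_assoc_def[of _ f] rwhisker_assoc_def[of _ f']
    by (rule sq_trans[OF g fzt Rt\<alpha> RR\<beta> Rt\<beta> vcomp_hom[OF ia(1) w(1)] vcomp_hom[OF ia(2) w(2)]
          iso2_hom2[OF a(3)] iso2_hom2[OF a(4)] s12 s3])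
qed

end

section \<open>Weak pullbacks and local faithfulness\<close>

context BF
begin

lemma W_iso:
  assumes "\<alpha> \<in> iso2 C v w" "v \<in> hom1 C X Y"
  shows "v \<in> W \<longleftrightarrow> w \<in> W"
proof -
  have "w \<in> hom1 C X Y" using assms hom2_hom1 iso2_hom2 by blast
  then show ?thesis using BF5 assms inv2_iso by blast
qed

text \<open>BF3 does not apply to \<open>f\<close>, which need not be in \<open>W\<close>. Applied
  to \<open>w \<odot> f\<close> against \<open>w \<odot> g\<close> it gives an isomorphism with
  \<open>w\<close> in front, and BF4 strips \<open>w\<close> at the cost of a restriction along some
  \<open>t\<close> in \<open>W\<close>, which keeps \<open>q\<close> in \<open>W\<close>.\<close>

lemma weak_pullback:
  assumes w: "w \<in> hom1 C Y Z" "w \<in> W" and f: "f \<in> hom1 C X Y" "w \<odot> f \<in> W" and g: "g \<in> hom1 C X' Y"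
  obtains V p q \<phi> where "p \<in> hom1 C V X" "q \<in> hom1 C V X'" "q \<in> W" "\<phi> \<in> iso2 C (f \<odot> p) (g \<odot> q)"
proof -
  obtain D q p \<alpha> where q: "q \<in> hom1 C D X'" "q \<in> W" and p: "p \<in> hom1 C D X"
    and \<alpha>: "\<alpha> \<in> iso2 C ((w \<odot> g) \<odot> q) ((w \<odot> f) \<odot> p)"
    using BF3[OF comp1_hom[OF f(1) w(1)] f(2) comp1_hom[OF g w(1)]] by blast
  let ?\<alpha> = "assoc C w f p \<bullet> \<alpha> \<bullet> inv2 C (assoc C w g q)"
  have "?\<alpha> \<in> iso2 C (w \<odot> (g \<odot> q)) (w \<odot> (f \<odot> p))"
    using \<alpha> assoc_iso[OF p f(1) w(1)] inv2_iso[OF assoc_iso[OF q(1) g w(1)]]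
    by (blast intro: vcomp_iso)
  then obtain E t \<beta> where t: "t \<in> hom1 C E D" "t \<in> W" and \<beta>: "\<beta> \<in> iso2 C ((g \<odot> q) \<odot> t) ((f \<odot> p) \<odot> t)"
    using BF4ab[OF w comp1_hom[OF q(1) g] comp1_hom[OF p f(1)]] iso2_hom2
    unfolding BF4_triples_def by blast
  have "assoc C g q t \<bullet> inv2 C \<beta> \<bullet> inv2 C (assoc C f p t) \<in> iso2 C (f \<odot> (p \<odot> t)) (g \<odot> (q \<odot> t))"
    using assoc_iso[OF t(1) q(1) g] inv2_iso[OF \<beta>] inv2_iso[OF assoc_iso[OF t(1) p f(1)]]
    by (blast intro: vcomp_iso)
  then show thesis
    using that comp1_hom[OF t(1) p] comp1_hom[OF t(1) q(1)] BF2[OF t(1) q(1) t(2) q(2)] by blast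
qed

text \<open>A substitute for cancelling \<open>w\<close>: the weak pullback of \<open>v\<close>
  along the identity of \<open>Y\<close> exhibits \<open>v \<odot> p\<close> as isomorphic to an
  element of \<open>W\<close>.\<close>

lemma W_right_factor:
  assumes w: "w \<in> hom1 C Y Z" "w \<in> W" and v: "v \<in> hom1 C X Y" "w \<odot> v \<in> W"
  obtains V p where "p \<in> hom1 C V X" "v \<odot> p \<in> W"
proof -
  have Y: "Y \<in> Obj C" using w src_Obj by (auto simp: hom1_def)
  obtain V p q \<phi> where p: "p \<in> hom1 C V X" and q: "q \<in> hom1 C V Y" "q \<in> W"
    and \<phi>: "\<phi> \<in> iso2 C (v \<odot> p) (id1 C Y \<odot> q)"
    by (rule weak_pullback[OF w v id1_hom[OF Y]])
  have "v \<odot> p \<in> W"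
    using W_iso[OF vcomp_iso[OF \<phi> lunit_iso[OF q(1)]] comp1_hom[OF p v(1)]] q by blast
  then show thesis using that p by blast
qed

text \<open>BF4c is a uniqueness clause for lifts of one 2-cell through \<open>w\<close>. Here
  \<beta> and \<beta>' lift the same 2-cell, and uniqueness up to refinement becomes equality after
  restriction.\<close>

lemma W_locally_faithful:
  assumes w: "w \<in> hom1 C Y Z" "w \<in> W" and f: "f \<in> hom1 C X Y" "f' \<in> hom1 C X Y"
    and \<beta>: "\<beta> \<in> hom2 C f f'" "\<beta>' \<in> hom2 C f f'" "w \<triangleleft> \<beta> = w \<triangleleft> \<beta>'"
  obtains V u where "u \<in> hom1 C V X" "u \<in> W" "\<beta> \<triangleright> u = \<beta>' \<triangleright> u"
proof -
  let ?i = "id1 C X"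
  have X: "X \<in> Obj C" using f src_Obj by (auto simp: hom1_def)
  note i = id1_hom[OF X]
  \<comment> \<open>Lifts in BF4 live over some element of \<open>W\<close>; the identity serves, at
    the price of whiskering by it.\<close>
  have tr: "(X, ?i, \<gamma> \<triangleright> ?i) \<in> BF4_triples C W X w f f' (w \<triangleleft> \<beta>)"
    if "\<gamma> \<in> hom2 C f f'" "w \<triangleleft> \<gamma> = w \<triangleleft> \<beta>" for \<gamma>
    using i BF1[OF X] whisker_hom2(2)[OF i f(1) that(1)] rw_lwhisker[OF i f(1) w(1) that(1)]
    unfolding that(2) BF4_triples_def by simp
  obtain E u u' \<zeta> where u: "u \<in> hom1 C E X" "u' \<in> hom1 C E X"
    and \<zeta>: "\<zeta> \<in> iso2 C (?i \<odot> u) (?i \<odot> u')" and W: "?i \<odot> u \<in> W"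
    and eq: "rw f ?i f' ?i (\<beta>' \<triangleright> ?i) u' \<bullet> (f \<triangleleft> \<zeta>) = (f' \<triangleleft> \<zeta>) \<bullet> rw f ?i f' ?i (\<beta> \<triangleright> ?i) u"
    using BF4c[OF w f whisker_hom2(1)[OF f(1) w(1) \<beta>(1)] tr[OF \<beta>(1) refl] tr[OF \<beta>(2) \<beta>(3)[symmetric]]]
    by (elim exE conjE) (rule that)
  note iu = comp1_hom[OF u(1) i] comp1_hom[OF u(2) i]
  have "(\<beta>' \<triangleright> (?i \<odot> u')) \<bullet> (f \<triangleleft> \<zeta>) = (f' \<triangleleft> \<zeta>) \<bullet> (\<beta> \<triangleright> (?i \<odot> u))"
    using eq rw_rwhisker[OF u(2) i f(1) \<beta>(2)] rw_rwhisker[OF u(1) i f(1) \<beta>(1)] by simp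
  \<comment> \<open>Exchange moves \<zeta> across \<beta>, so that both sides are precomposed with
    the same invertible \<open>f \<triangleleft> \<zeta>\<close>, which cancels.\<close>
  also have "\<dots> = (\<beta> \<triangleright> (?i \<odot> u')) \<bullet> (f \<triangleleft> \<zeta>)"
    by (rule whisker_exchange[OF iu(1) f(1) iso2_hom2[OF \<zeta>] \<beta>(1)])
  finally have "\<beta>' \<triangleright> (?i \<odot> u') = \<beta> \<triangleright> (?i \<odot> u')"
    using whisker_hom2(2)[OF iu(2) f(1) \<beta>(1)] whisker_hom2(2)[OF iu(2) f(1) \<beta>(2)]
    by (elim iso2_cancel_right[OF lwhisker_iso(1)[OF iu(1) f(1) \<zeta>], rotated -1])
      (simp_all add: hom2_def)
  then show thesis using that[OF iu(2) _ sym] W_iso[OF \<zeta> iu(1)] W by blast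
qed

end

section \<open>Representatives of 2-morphisms of fractions\<close>

text \<open>The relation on representatives is defined by conjugation, with one isomorphism pointing
  backwards; moving that whiskered isomorphism across the equation gives the square form.\<close>

lemma (in bicategory) sq_eq_conjugate:
  assumes "g \<in> hom1 C Y Z" "f \<in> hom1 C X Y" "\<sigma> \<in> iso2 C f h"
    and "\<alpha> \<in> hom2 C (g \<odot> f) (g' \<odot> f')" "\<beta> \<in> hom2 C (g \<odot> h) (g' \<odot> h')"
    and "g' \<triangleleft> \<sigma>' \<in> hom2 C (g' \<odot> f') (g' \<odot> h')"
  shows "sq g g' \<sigma> \<sigma>' \<alpha> \<beta> \<longleftrightarrow> (g' \<triangleleft> \<sigma>') \<bullet> \<alpha> \<bullet> (g \<triangleleft> inv2 C \<sigma>) = \<beta>"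
proof -
  have h: "h \<in> hom1 C X Y" using assms(2,3) hom2_hom1 iso2_hom2 by blast
  note w = lwhisker_iso[OF assms(2,1,3)]
  note types = iso2_hom2[OF w(1)] whisker_hom2(1)[OF h assms(1) iso2_hom2[OF inv2_iso[OF assms(3)]]]
  show ?thesis
  proof
    assume "sq g g' \<sigma> \<sigma>' \<alpha> \<beta>"
    then have "((g' \<triangleleft> \<sigma>') \<bullet> \<alpha>) \<bullet> (g \<triangleleft> inv2 C \<sigma>) = (\<beta> \<bullet> (g \<triangleleft> \<sigma>)) \<bullet> (g \<triangleleft> inv2 C \<sigma>)"
      by (simp add: sq_def)
    then show "(g' \<triangleleft> \<sigma>') \<bullet> \<alpha> \<bullet> (g \<triangleleft> inv2 C \<sigma>) = \<beta>"
      using assms types w(3) by (simp add: cell_simps)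
  next
    assume "(g' \<triangleleft> \<sigma>') \<bullet> \<alpha> \<bullet> (g \<triangleleft> inv2 C \<sigma>) = \<beta>"
    then have "\<beta> \<bullet> (g \<triangleleft> \<sigma>) = ((g' \<triangleleft> \<sigma>') \<bullet> \<alpha> \<bullet> (g \<triangleleft> inv2 C \<sigma>)) \<bullet> (g \<triangleleft> \<sigma>)"
      by simp
    also have "\<dots> = (g' \<triangleleft> \<sigma>') \<bullet> \<alpha>"
      using assms types w(2) by (simp add: cell_simps)
    finally show "sq g g' \<sigma> \<sigma>' \<alpha> \<beta>" by (simp add: sq_def)
  qed
qed

lemma (in bicategory) inv2_inv2:
  assumes "\<alpha> \<in> iso2 C f g"
  shows "inv2 C (inv2 C \<alpha>) = \<alpha>"
proof (rule iso2_cancel_right)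
  show "inv2 C \<alpha> \<in> iso2 C g f" by (rule inv2_iso[OF assms])
  then show "inv2 C (inv2 C \<alpha>) \<bullet> inv2 C \<alpha> = \<alpha> \<bullet> inv2 C \<alpha>"
    using inv2_simps(7)[of "inv2 C \<alpha>" g f] inv2_simps(8)[OF assms] by simp
qed (simp_all add: inv2_simps[OF assms] inv2_simps[OF inv2_iso[OF assms]])

locale frac_pair = BF C W
  for C :: "('o, 'm, 'c) bicat" (structure) and W :: "'m set" +
  fixes A B A1 A2 :: 'o and w1 f1 w2 f2 :: 'm
  assumes w1: "w1 \<in> hom1 C A1 A" "w1 \<in> W" and w2: "w2 \<in> hom1 C A2 A" "w2 \<in> W"
    and f1: "f1 \<in> hom1 C A1 B" and f2: "f2 \<in> hom1 C A2 B"
begin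

text \<open>
  The condition \<open>w1 \<odot> v1 \<in> W\<close> is kept apart from \<open>squares\<close>, so that \<open>squares\<close> is stable under
  restriction along arbitrary 1-cells.
\<close>

definition squares :: "'o \<Rightarrow> ('m \<times> 'm \<times> 'c \<times> 'c) set" where
  "squares X = {(v1, v2, \<alpha>, \<beta>). v1 \<in> hom1 C X A1 \<and> v2 \<in> hom1 C X A2 \<and>
     \<alpha> \<in> iso2 C (w1 \<odot> v1) (w2 \<odot> v2) \<and> \<beta> \<in> hom2 C (f1 \<odot> v1) (f2 \<odot> v2)}"

definition admissible :: "'m \<times> 'm \<times> 'c \<times> 'c \<Rightarrow> bool" where
  "admissible d \<longleftrightarrow> w1 \<odot> fst d \<in> W"

definition pull :: "'m \<times> 'm \<times> 'c \<times> 'c \<Rightarrow> 'm \<Rightarrow> 'm \<times> 'm \<times> 'c \<times> 'c" where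
  "pull = (\<lambda>(v1, v2, \<alpha>, \<beta>) z. (v1 \<odot> z, v2 \<odot> z, rw w1 v1 w2 v2 \<alpha> z, rw f1 v1 f2 v2 \<beta> z))"

definition square_iso :: "'o \<Rightarrow> 'm \<times> 'm \<times> 'c \<times> 'c \<Rightarrow> 'm \<times> 'm \<times> 'c \<times> 'c \<Rightarrow> bool" where
  "square_iso X = (\<lambda>(v1, v2, \<alpha>, \<beta>) (v1', v2', \<alpha>', \<beta>').
     (v1, v2, \<alpha>, \<beta>) \<in> squares X \<and> (v1', v2', \<alpha>', \<beta>') \<in> squares X \<and>
     (\<exists>\<sigma>1 \<sigma>2. \<sigma>1 \<in> iso2 C v1 v1' \<and> \<sigma>2 \<in> iso2 C v2 v2' \<and>
        sq w1 w2 \<sigma>1 \<sigma>2 \<alpha> \<alpha>' \<and> sq f1 f2 \<sigma>1 \<sigma>2 \<beta> \<beta>'))"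

abbreviation "rep \<equiv> frac_rep C W (A1, w1, f1) (A2, w2, f2)"
abbreviation "rel \<equiv> frac_rel C W (A1, w1, f1) (A2, w2, f2)"

lemma rep_iff: "(X, d) \<in> rep \<longleftrightarrow> d \<in> squares X \<and> admissible d"
  by (cases d) (auto simp: frac_rep_def squares_def admissible_def)

lemma pull_squares:
  assumes "d \<in> squares X" "z \<in> hom1 C V X"
  shows "pull d z \<in> squares V"
  using assms comp1_hom[OF assms(2)] rw_iso[OF assms(2) _ w1(1) _ w2(1)]
    rw_hom2[OF assms(2) _ f1 _ f2]
  by (auto simp: squares_def pull_def)

lemma square_iso_squares:
  assumes "square_iso X d d'"
  shows "d \<in> squares X" "d' \<in> squares X"
  using assms by (auto simp: square_iso_def split: prod.splits)

lemma square_iso_refl: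
  assumes "d \<in> squares X"
  shows "square_iso X d d"
proof -
  obtain v1 v2 \<alpha> \<beta> where d: "d = (v1, v2, \<alpha>, \<beta>)" by (cases d) auto
  have v: "v1 \<in> hom1 C X A1" "v2 \<in> hom1 C X A2"
    and \<alpha>: "\<alpha> \<in> hom2 C (w1 \<odot> v1) (w2 \<odot> v2)" and \<beta>: "\<beta> \<in> hom2 C (f1 \<odot> v1) (f2 \<odot> v2)"
    using assms iso2_hom2 by (auto simp: d squares_def)
  have "id2 C v1 \<in> iso2 C v1 v1" "id2 C v2 \<in> iso2 C v2 v2"
    using v id2_iso by (auto simp: hom1_def)
  then show ?thesis
    using assms sq_refl[OF v(1) w1(1) v(2) w2(1) \<alpha>] sq_refl[OF v(1) f1 v(2) f2 \<beta>]
    unfolding d square_iso_def by blast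
qed

lemma square_iso_sym:
  assumes "square_iso X d d'"
  shows "square_iso X d' d"
proof -
  obtain v1 v2 \<alpha> \<beta> v1' v2' \<alpha>' \<beta>' where d: "d = (v1, v2, \<alpha>, \<beta>)" "d' = (v1', v2', \<alpha>', \<beta>')"
    by (cases d, cases d') auto
  have v: "v1 \<in> hom1 C X A1" "v2 \<in> hom1 C X A2"
    and \<alpha>: "\<alpha> \<in> hom2 C (w1 \<odot> v1) (w2 \<odot> v2)" "\<alpha>' \<in> hom2 C (w1 \<odot> v1') (w2 \<odot> v2')"
    and \<beta>: "\<beta> \<in> hom2 C (f1 \<odot> v1) (f2 \<odot> v2)" "\<beta>' \<in> hom2 C (f1 \<odot> v1') (f2 \<odot> v2')"
    using square_iso_squares[OF assms] iso2_hom2 by (auto simp: d squares_def)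
  obtain \<sigma>1 \<sigma>2 where \<sigma>: "\<sigma>1 \<in> iso2 C v1 v1'" "\<sigma>2 \<in> iso2 C v2 v2'"
    and sq: "sq w1 w2 \<sigma>1 \<sigma>2 \<alpha> \<alpha>'" "sq f1 f2 \<sigma>1 \<sigma>2 \<beta> \<beta>'"
    using assms unfolding d square_iso_def by blast
  show ?thesis
    using square_iso_squares[OF assms] inv2_iso[OF \<sigma>(1)] inv2_iso[OF \<sigma>(2)]
      sq_sym[OF w1(1) w2(1) v \<alpha> \<sigma> sq(1)] sq_sym[OF f1 f2 v \<beta> \<sigma> sq(2)]
    unfolding d square_iso_def by blast
qed

lemma square_iso_trans:
  assumes "square_iso X d d'" "square_iso X d' d''"
  shows "square_iso X d d''"
proof -
  obtain v1 v2 \<alpha> \<beta> v1' v2' \<alpha>' \<beta>' v1'' v2'' \<alpha>'' \<beta>'' where d: "d = (v1, v2, \<alpha>, \<beta>)"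
    "d' = (v1', v2', \<alpha>', \<beta>')" "d'' = (v1'', v2'', \<alpha>'', \<beta>'')"
    by (cases d, cases d', cases d'') auto
  have v: "v1 \<in> hom1 C X A1" "v2 \<in> hom1 C X A2"
    and \<alpha>: "\<alpha> \<in> hom2 C (w1 \<odot> v1) (w2 \<odot> v2)" "\<alpha>' \<in> hom2 C (w1 \<odot> v1') (w2 \<odot> v2')"
      "\<alpha>'' \<in> hom2 C (w1 \<odot> v1'') (w2 \<odot> v2'')"
    and \<beta>: "\<beta> \<in> hom2 C (f1 \<odot> v1) (f2 \<odot> v2)" "\<beta>' \<in> hom2 C (f1 \<odot> v1') (f2 \<odot> v2')"
      "\<beta>'' \<in> hom2 C (f1 \<odot> v1'') (f2 \<odot> v2'')"
    using square_iso_squares[OF assms(1)] square_iso_squares[OF assms(2)] iso2_hom2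
    by (auto simp: d squares_def)
  obtain \<sigma>1 \<sigma>2 where \<sigma>: "\<sigma>1 \<in> iso2 C v1 v1'" "\<sigma>2 \<in> iso2 C v2 v2'"
    and sq: "sq w1 w2 \<sigma>1 \<sigma>2 \<alpha> \<alpha>'" "sq f1 f2 \<sigma>1 \<sigma>2 \<beta> \<beta>'"
    using assms(1) unfolding d square_iso_def by blast
  obtain \<tau>1 \<tau>2 where \<tau>: "\<tau>1 \<in> iso2 C v1' v1''" "\<tau>2 \<in> iso2 C v2' v2''"
    and sq': "sq w1 w2 \<tau>1 \<tau>2 \<alpha>' \<alpha>''" "sq f1 f2 \<tau>1 \<tau>2 \<beta>' \<beta>''"
    using assms(2) unfolding d square_iso_def by blast
  note h = iso2_hom2[OF \<sigma>(1)] iso2_hom2[OF \<sigma>(2)] iso2_hom2[OF \<tau>(1)] iso2_hom2[OF \<tau>(2)]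
  show ?thesis
    using square_iso_squares(1)[OF assms(1)] square_iso_squares(2)[OF assms(2)]
      vcomp_iso[OF \<sigma>(1) \<tau>(1)] vcomp_iso[OF \<sigma>(2) \<tau>(2)]
      sq_trans[OF w1(1) w2(1) v \<alpha> h sq(1) sq'(1)] sq_trans[OF f1 f2 v \<beta> h sq(2) sq'(2)]
    unfolding d square_iso_def by blast
qed

lemma square_iso_pull:
  assumes "square_iso X d d'" "z \<in> hom1 C V X"
  shows "square_iso V (pull d z) (pull d' z)"
proof -
  obtain v1 v2 \<alpha> \<beta> v1' v2' \<alpha>' \<beta>' where d: "d = (v1, v2, \<alpha>, \<beta>)" "d' = (v1', v2', \<alpha>', \<beta>')"
    by (cases d, cases d') auto
  have v: "v1 \<in> hom1 C X A1" "v2 \<in> hom1 C X A2"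
    and \<alpha>: "\<alpha> \<in> hom2 C (w1 \<odot> v1) (w2 \<odot> v2)" "\<alpha>' \<in> hom2 C (w1 \<odot> v1') (w2 \<odot> v2')"
    and \<beta>: "\<beta> \<in> hom2 C (f1 \<odot> v1) (f2 \<odot> v2)" "\<beta>' \<in> hom2 C (f1 \<odot> v1') (f2 \<odot> v2')"
    using square_iso_squares[OF assms(1)] iso2_hom2 by (auto simp: d squares_def)
  obtain \<sigma>1 \<sigma>2 where \<sigma>: "\<sigma>1 \<in> iso2 C v1 v1'" "\<sigma>2 \<in> iso2 C v2 v2'"
    and sq: "sq w1 w2 \<sigma>1 \<sigma>2 \<alpha> \<alpha>'" "sq f1 f2 \<sigma>1 \<sigma>2 \<beta> \<beta>'"
    using assms(1) unfolding d square_iso_def by blast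
  note h = iso2_hom2[OF \<sigma>(1)] iso2_hom2[OF \<sigma>(2)]
  show ?thesis
    using pull_squares[OF square_iso_squares(1)[OF assms(1)] assms(2)]
      pull_squares[OF square_iso_squares(2)[OF assms(1)] assms(2)]
      rwhisker_iso[OF assms(2) v(1) \<sigma>(1)] rwhisker_iso[OF assms(2) v(2) \<sigma>(2)]
      sq_rwhisker[OF assms(2) w1(1) w2(1) v \<alpha> h sq(1)] sq_rwhisker[OF assms(2) f1 f2 v \<beta> h sq(2)]
    unfolding d square_iso_def pull_def by auto
qed

text \<open>The comparison isomorphisms are the associators of \<open>v1\<close> and
  \<open>v2\<close> with \<open>z\<close> and \<open>t\<close>; their two squares are instances of
  \<open>rw_comp1\<close>.\<close>

lemma square_iso_pull_comp1:
  assumes d: "d \<in> squares X" and z: "z \<in> hom1 C V X" and t: "t \<in> hom1 C U V"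
  shows "square_iso U (pull (pull d z) t) (pull d (z \<odot> t))"
proof -
  obtain v1 v2 \<alpha> \<beta> where d': "d = (v1, v2, \<alpha>, \<beta>)" by (cases d) auto
  have v: "v1 \<in> hom1 C X A1" "v2 \<in> hom1 C X A2"
    and \<alpha>: "\<alpha> \<in> hom2 C (w1 \<odot> v1) (w2 \<odot> v2)" and \<beta>: "\<beta> \<in> hom2 C (f1 \<odot> v1) (f2 \<odot> v2)"
    using d iso2_hom2 by (auto simp: d' squares_def)
  show ?thesis
    using pull_squares[OF pull_squares[OF d z] t] pull_squares[OF d comp1_hom[OF t z]]
      assoc_iso[OF t z v(1)] assoc_iso[OF t z v(2)]
      rw_comp1[OF t z v w1(1) w2(1) \<alpha>] rw_comp1[OF t z v f1 f2 \<beta>]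
    unfolding d' square_iso_def pull_def sq_def by auto
qed

text \<open>The comparison isomorphisms are \<open>v1 \<triangleleft> \<tau>\<close> and
  \<open>v2 \<triangleleft> \<tau>\<close>, with squares from \<open>rw_natural\<close>.\<close>

lemma square_iso_pull_cell:
  assumes d: "d \<in> squares X" and z: "z \<in> hom1 C V X" and \<tau>: "\<tau> \<in> iso2 C z z'"
  shows "square_iso V (pull d z) (pull d z')"
proof -
  obtain v1 v2 \<alpha> \<beta> where d': "d = (v1, v2, \<alpha>, \<beta>)" by (cases d) auto
  have v: "v1 \<in> hom1 C X A1" "v2 \<in> hom1 C X A2"
    and \<alpha>: "\<alpha> \<in> hom2 C (w1 \<odot> v1) (w2 \<odot> v2)" and \<beta>: "\<beta> \<in> hom2 C (f1 \<odot> v1) (f2 \<odot> v2)"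
    using d iso2_hom2 by (auto simp: d' squares_def)
  have z': "z' \<in> hom1 C V X" using hom2_hom1 iso2_hom2 \<tau> z by blast
  show ?thesis
    using pull_squares[OF d z] pull_squares[OF d z']
      lwhisker_iso(1)[OF z v(1) \<tau>] lwhisker_iso(1)[OF z v(2) \<tau>]
      rw_natural[OF z v(1) w1(1) v(2) w2(1) \<alpha> iso2_hom2[OF \<tau>]]
      rw_natural[OF z v(1) f1 v(2) f2 \<beta> iso2_hom2[OF \<tau>]]
    unfolding d' square_iso_def pull_def sq_def by auto
qed

lemma admissible_pull_iff:
  assumes "d \<in> squares X" "z \<in> hom1 C V X"
  shows "admissible (pull d z) \<longleftrightarrow> (w1 \<odot> fst d) \<odot> z \<in> W"
proof -
  have v: "fst d \<in> hom1 C X A1" using assms by (auto simp: squares_def)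
  have "(w1 \<odot> fst d) \<odot> z \<in> W \<longleftrightarrow> w1 \<odot> (fst d \<odot> z) \<in> W"
    by (rule W_iso[OF assoc_iso[OF assms(2) v w1(1)]]) (use assms v w1 comp1_hom in blast)
  then show ?thesis by (cases d) (simp add: admissible_def pull_def)
qed

lemma admissible_pull:
  assumes "d \<in> squares X" "admissible d" "z \<in> hom1 C V X" "z \<in> W"
  shows "admissible (pull d z)"
proof -
  have "fst d \<in> hom1 C X A1" using assms by (auto simp: squares_def)
  then show ?thesis
    using assms BF2[OF assms(3) comp1_hom[OF _ w1(1)] assms(4)] admissible_pull_iff[OF assms(1,3)]
    by (simp add: admissible_def)
qed

text \<open>The relation imposes its membership condition on one of the two restrictions only; by
  this invariance the other satisfies it too, which symmetry needs.\<close>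

lemma admissible_iso:
  assumes "square_iso X d d'"
  shows "admissible d \<longleftrightarrow> admissible d'"
proof -
  obtain \<sigma> where v: "fst d \<in> hom1 C X A1" and \<sigma>: "\<sigma> \<in> iso2 C (fst d) (fst d')"
    using assms by (auto simp: square_iso_def squares_def split: prod.splits)
  show ?thesis
    using W_iso[OF lwhisker_iso(1)[OF v w1(1) \<sigma>] comp1_hom[OF v w1(1)]]
    by (simp add: admissible_def)
qed

text \<open>The definition orients \<sigma>1 and \<sigma>2 oppositely. Inverting the first turns the
  two equations into the squares of an isomorphism, so later proofs can argue with
  \<open>pull\<close> and \<open>square_iso\<close> instead of with the equations.\<close>

lemma rel_iff:
  "((X, d), (X', d')) \<in> rel \<longleftrightarrow> (X, d) \<in> rep \<and> (X', d') \<in> rep \<and>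
     (\<exists>V z z'. z \<in> hom1 C V X \<and> z' \<in> hom1 C V X' \<and> admissible (pull d z) \<and>
        square_iso V (pull d z) (pull d' z'))" (is "?l \<longleftrightarrow> ?r")
proof -
  obtain v1 v2 \<alpha> \<beta> v1' v2' \<alpha>' \<beta>' where d: "d = (v1, v2, \<alpha>, \<beta>)" "d' = (v1', v2', \<alpha>', \<beta>')"
    by (cases d, cases d') auto
  have conj: "((w2 \<triangleleft> \<sigma>2) \<bullet> rw w1 v1 w2 v2 \<alpha> z \<bullet> (w1 \<triangleleft> inv2 C \<sigma>1) = rw w1 v1' w2 v2' \<alpha>' z'
       \<longleftrightarrow> sq w1 w2 \<sigma>1 \<sigma>2 (rw w1 v1 w2 v2 \<alpha> z) (rw w1 v1' w2 v2' \<alpha>' z'))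
     \<and> ((f2 \<triangleleft> \<sigma>2) \<bullet> rw f1 v1 f2 v2 \<beta> z \<bullet> (f1 \<triangleleft> inv2 C \<sigma>1) = rw f1 v1' f2 v2' \<beta>' z'
       \<longleftrightarrow> sq f1 f2 \<sigma>1 \<sigma>2 (rw f1 v1 f2 v2 \<beta> z) (rw f1 v1' f2 v2' \<beta>' z'))"
    if "d \<in> squares X" "d' \<in> squares X'" "z \<in> hom1 C V X" "z' \<in> hom1 C V X'"
      and \<sigma>: "\<sigma>1 \<in> iso2 C (v1 \<odot> z) (v1' \<odot> z')" "\<sigma>2 \<in> iso2 C (v2 \<odot> z) (v2' \<odot> z')"
    for V z z' \<sigma>1 \<sigma>2
  proof -
    have v: "v1 \<odot> z \<in> hom1 C V A1" "v2 \<odot> z \<in> hom1 C V A2"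
      and R: "rw w1 v1 w2 v2 \<alpha> z \<in> hom2 C (w1 \<odot> (v1 \<odot> z)) (w2 \<odot> (v2 \<odot> z))"
        "rw f1 v1 f2 v2 \<beta> z \<in> hom2 C (f1 \<odot> (v1 \<odot> z)) (f2 \<odot> (v2 \<odot> z))"
        "rw w1 v1' w2 v2' \<alpha>' z' \<in> hom2 C (w1 \<odot> (v1' \<odot> z')) (w2 \<odot> (v2' \<odot> z'))"
        "rw f1 v1' f2 v2' \<beta>' z' \<in> hom2 C (f1 \<odot> (v1' \<odot> z')) (f2 \<odot> (v2' \<odot> z'))"
      using pull_squares[OF that(1,3)] pull_squares[OF that(2,4)] iso2_hom2
      unfolding d pull_def squares_def by auto
    show ?thesis
      using sq_eq_conjugate[OF w1(1) v(1) \<sigma>(1) R(1,3) whisker_hom2(1)[OF v(2) w2(1) iso2_hom2[OF \<sigma>(2)]]]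
        sq_eq_conjugate[OF f1 v(1) \<sigma>(1) R(2,4) whisker_hom2(1)[OF v(2) f2 iso2_hom2[OF \<sigma>(2)]]]
      by simp
  qed
  show ?thesis
  proof
    assume l: ?l
    then have r: "(X, d) \<in> rep" "(X', d') \<in> rep" by (auto simp: d frac_rel_def)
    then have s: "d \<in> squares X" "d' \<in> squares X'" by (simp_all add: rep_iff)
    obtain V z z' \<sigma>1 \<sigma>2 where z: "z \<in> hom1 C V X" "z' \<in> hom1 C V X'"
      and \<sigma>: "\<sigma>1 \<in> iso2 C (v1' \<odot> z') (v1 \<odot> z)" "\<sigma>2 \<in> iso2 C (v2 \<odot> z) (v2' \<odot> z')"
      and W: "(w1 \<odot> v1) \<odot> z \<in> W"
      and eq: "(w2 \<triangleleft> \<sigma>2) \<bullet> rw w1 v1 w2 v2 \<alpha> z \<bullet> (w1 \<triangleleft> \<sigma>1) = rw w1 v1' w2 v2' \<alpha>' z'"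
        "(f2 \<triangleleft> \<sigma>2) \<bullet> rw f1 v1 f2 v2 \<beta> z \<bullet> (f1 \<triangleleft> \<sigma>1) = rw f1 v1' f2 v2' \<beta>' z'"
      using l by (auto simp: d frac_rel_def)
    have "square_iso V (pull d z) (pull d' z')"
      using conj[OF s z inv2_iso[OF \<sigma>(1)] \<sigma>(2)] inv2_iso[OF \<sigma>(1)] \<sigma>(2) eq inv2_inv2[OF \<sigma>(1)]
        pull_squares[OF s(1) z(1)] pull_squares[OF s(2) z(2)]
      unfolding d pull_def square_iso_def by auto
    then show ?r using r z W admissible_pull_iff[OF s(1) z(1)] by (auto simp: d)
  next
    assume ?r
    then obtain V z z' where r: "(X, d) \<in> rep" "(X', d') \<in> rep"
      and z: "z \<in> hom1 C V X" "z' \<in> hom1 C V X'" and W: "admissible (pull d z)"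
      and iso: "square_iso V (pull d z) (pull d' z')" by blast
    have s: "d \<in> squares X" "d' \<in> squares X'" using r by (simp_all add: rep_iff)
    obtain \<sigma>1 \<sigma>2 where \<sigma>: "\<sigma>1 \<in> iso2 C (v1 \<odot> z) (v1' \<odot> z')" "\<sigma>2 \<in> iso2 C (v2 \<odot> z) (v2' \<odot> z')"
      and sq: "sq w1 w2 \<sigma>1 \<sigma>2 (rw w1 v1 w2 v2 \<alpha> z) (rw w1 v1' w2 v2' \<alpha>' z')"
        "sq f1 f2 \<sigma>1 \<sigma>2 (rw f1 v1 f2 v2 \<beta> z) (rw f1 v1' f2 v2' \<beta>' z')"
      using iso unfolding d pull_def square_iso_def by auto
    have "(w2 \<triangleleft> \<sigma>2) \<bullet> rw w1 v1 w2 v2 \<alpha> z \<bullet> (w1 \<triangleleft> inv2 C \<sigma>1) = rw w1 v1' w2 v2' \<alpha>' z'"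
      "(f2 \<triangleleft> \<sigma>2) \<bullet> rw f1 v1 f2 v2 \<beta> z \<bullet> (f1 \<triangleleft> inv2 C \<sigma>1) = rw f1 v1' f2 v2' \<beta>' z'"
      using conj[OF s z \<sigma>] sq by blast+
    moreover have "(w1 \<odot> v1) \<odot> z \<in> W" using W admissible_pull_iff[OF s(1) z(1)] by (simp add: d)
    ultimately show ?l
      using r z inv2_iso[OF \<sigma>(1)] \<sigma>(2) unfolding d frac_rel_def by fast
  qed
qed

section \<open>The relation on representatives is an equivalence\<close>

lemma obj_id1_W:
  assumes "d \<in> squares X"
  shows "id1 C X \<in> hom1 C X X" "id1 C X \<in> W"
proof -
  have "X \<in> Obj C" using assms src_Obj by (auto simp: squares_def hom1_def)
  then show "id1 C X \<in> hom1 C X X" "id1 C X \<in> W" using id1_hom BF1 by auto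
qed

lemma rel_square_iso:
  assumes "square_iso X d d'" "admissible d"
  shows "((X, d), (X, d')) \<in> rel"
proof -
  note d = square_iso_squares[OF assms(1)] and i = obj_id1_W[OF square_iso_squares(1)[OF assms(1)]]
  show ?thesis
    using d i assms(2) admissible_iso[OF assms(1)] admissible_pull[OF d(1) assms(2) i]
      square_iso_pull[OF assms(1) i(1)]
    unfolding rel_iff rep_iff by blast
qed

text \<open>The witnesses are \<open>z \<odot> id1 C V\<close> on one side and
  \<open>id1 C V\<close> on the other, again avoiding unitors: the two restrictions differ by an
  associator only.\<close>

lemma rel_pull:
  assumes d: "d \<in> squares X" "admissible d" and z: "z \<in> hom1 C V X" and W: "admissible (pull d z)"
  shows "((X, d), (V, pull d z)) \<in> rel"
proof -
  note p = pull_squares[OF d(1) z]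
  note i = obj_id1_W[OF p]
  note iso = square_iso_sym[OF square_iso_pull_comp1[OF d(1) z i(1)]]
  show ?thesis
    using d p W i comp1_hom[OF i(1) z] iso admissible_iso[OF iso] admissible_pull[OF p W i]
    unfolding rel_iff rep_iff by blast
qed

lemma equiv_rel: "equiv rep rel"
proof (rule equivI)
  show "rel \<subseteq> rep \<times> rep" by (auto simp: frac_rel_def)
  show "refl_on rep rel"
  proof (rule refl_onI)
    fix x assume "x \<in> rep"
    then show "(x, x) \<in> rel"
      using rel_square_iso[OF square_iso_refl] by (cases x) (auto simp: rep_iff)
  qed
  show "sym rel"
  proof (rule symI)
    fix x y assume "(x, y) \<in> rel"
    then show "(y, x) \<in> rel"
      using square_iso_sym admissible_iso by (cases x; cases y) (simp only: rel_iff, blast)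
  qed
  show "trans rel"
  proof (rule transI)
    fix x y u assume xy: "(x, y) \<in> rel" and yu: "(y, u) \<in> rel"
    obtain X d X' d' X'' d'' where xyu: "x = (X, d)" "y = (X', d')" "u = (X'', d'')"
      by (cases x, cases y, cases u)
    have r: "(X, d) \<in> rep" "(X', d') \<in> rep" "(X'', d'') \<in> rep"
      using xy yu unfolding xyu rel_iff by blast+
    then have s: "d \<in> squares X" "d' \<in> squares X'" "d'' \<in> squares X''"
      by (simp_all add: rep_iff)
    obtain V z z' where z: "z \<in> hom1 C V X" "z' \<in> hom1 C V X'" and W: "admissible (pull d z)"
      and iso: "square_iso V (pull d z) (pull d' z')"
      using xy unfolding xyu rel_iff by blast
    obtain V' t t' where t: "t \<in> hom1 C V' X'" "t' \<in> hom1 C V' X''" and W': "admissible (pull d' t)"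
      and iso': "square_iso V' (pull d' t) (pull d'' t')"
      using yu unfolding xyu rel_iff by blast
    have v: "w1 \<odot> fst d' \<in> hom1 C X' A" "w1 \<odot> fst d' \<in> W"
      using s(2) r(2) comp1_hom w1 by (auto simp: squares_def rep_iff admissible_def)
    \<comment> \<open>The middle datum is restricted along \<open>z'\<close> and along
      \<open>t\<close>, neither of which need be in \<open>W\<close>. This membership suffices to
      complete them to a square over \<open>X'\<close>, with \<open>q\<close> in \<open>W\<close> so
      that admissibility survives.\<close>
    have "(w1 \<odot> fst d') \<odot> t \<in> W" using W' admissible_pull_iff s t by blast
    then obtain U p q \<phi> where p: "p \<in> hom1 C U V'" and q: "q \<in> hom1 C U V" "q \<in> W"
      and \<phi>: "\<phi> \<in> iso2 C (t \<odot> p) (z' \<odot> q)"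
      by (rule weak_pullback[OF v t(1) _ z(2)])
    have "square_iso U (pull d (z \<odot> q)) (pull (pull d z) q)"
      by (rule square_iso_sym[OF square_iso_pull_comp1[OF s(1) z(1) q(1)]])
    \<comment> \<open>Read from \<open>d\<close> to \<open>d''\<close>: the given isomorphisms are
      restricted along \<open>q\<close> and \<open>p\<close>, \<phi> joins the two restrictions of
      \<open>d'\<close>, and the other links regroup iterated restrictions.\<close>
    note sqs = this square_iso_pull[OF iso q(1)] square_iso_pull_comp1[OF s(2) z(2) q(1)]
      square_iso_sym[OF square_iso_pull_cell[OF s(2) comp1_hom[OF p t(1)] \<phi>]]
      square_iso_sym[OF square_iso_pull_comp1[OF s(2) t(1) p]]
      square_iso_pull[OF iso' p] square_iso_pull_comp1[OF s(3) t(2) p]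
    have "square_iso U (pull d (z \<odot> q)) (pull d'' (t' \<odot> p))"
      by (rule sqs(1)[THEN square_iso_trans, OF sqs(2)[THEN square_iso_trans],
            OF sqs(3)[THEN square_iso_trans], OF sqs(4)[THEN square_iso_trans],
            OF sqs(5)[THEN square_iso_trans], OF sqs(6)[THEN square_iso_trans], OF sqs(7)])
    moreover have "admissible (pull d (z \<odot> q))"
      using admissible_iso[OF sqs(1)] admissible_pull[OF pull_squares[OF s(1) z(1)] W q] by blast
    ultimately show "(x, u) \<in> rel"
      using r comp1_hom[OF q(1) z(1)] comp1_hom[OF p t(2)] unfolding xyu rel_iff by blast
  qed
qed

section \<open>A common representative for two 2-morphisms\<close>

lemma square_iso_transport_left:
  assumes d: "(v1', v2, \<alpha>, \<beta>) \<in> squares X" and v1: "v1 \<in> hom1 C X A1" and \<phi>: "\<phi> \<in> iso2 C v1 v1'"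
  shows "square_iso X (v1, v2, \<alpha> \<bullet> (w1 \<triangleleft> \<phi>), \<beta> \<bullet> (f1 \<triangleleft> \<phi>)) (v1', v2, \<alpha>, \<beta>)"
proof -
  have v2: "v2 \<in> hom1 C X A2" and \<alpha>: "\<alpha> \<in> iso2 C (w1 \<odot> v1') (w2 \<odot> v2)"
    and \<beta>: "\<beta> \<in> hom2 C (f1 \<odot> v1') (f2 \<odot> v2)"
    using d by (auto simp: squares_def)
  note t = vcomp_iso[OF lwhisker_iso(1)[OF v1 w1(1) \<phi>] \<alpha>]
    vcomp_hom[OF whisker_hom2(1)[OF v1 f1 iso2_hom2[OF \<phi>]] \<beta>]
  have "sq w1 w2 \<phi> (id2 C v2) (\<alpha> \<bullet> (w1 \<triangleleft> \<phi>)) \<alpha>" "sq f1 f2 \<phi> (id2 C v2) (\<beta> \<bullet> (f1 \<triangleleft> \<phi>)) \<beta>"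
    using vcomp_id_left iso2_hom2[OF t(1)] t(2)
    by (simp_all add: sq_def lwhisker_id2[OF v2 w2(1)] lwhisker_id2[OF v2 f2])
  moreover have "id2 C v2 \<in> iso2 C v2 v2" using v2 id2_iso by (simp add: hom1_def)
  moreover have "(v1, v2, \<alpha> \<bullet> (w1 \<triangleleft> \<phi>), \<beta> \<bullet> (f1 \<triangleleft> \<phi>)) \<in> squares X"
    using v1 v2 t by (simp add: squares_def)
  ultimately show ?thesis using d \<phi> unfolding square_iso_def by blast
qed

lemma square_iso_transport_right:
  assumes d: "(v1, v2, \<alpha>, \<beta>) \<in> squares X" and \<psi>: "\<psi> \<in> iso2 C v2 v2'"
  shows "square_iso X (v1, v2, \<alpha>, \<beta>) (v1, v2', (w2 \<triangleleft> \<psi>) \<bullet> \<alpha>, (f2 \<triangleleft> \<psi>) \<bullet> \<beta>)"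
proof -
  have v: "v1 \<in> hom1 C X A1" "v2 \<in> hom1 C X A2" and \<alpha>: "\<alpha> \<in> iso2 C (w1 \<odot> v1) (w2 \<odot> v2)"
    and \<beta>: "\<beta> \<in> hom2 C (f1 \<odot> v1) (f2 \<odot> v2)"
    using d by (auto simp: squares_def)
  have v2': "v2' \<in> hom1 C X A2" using hom2_hom1 v(2) iso2_hom2[OF \<psi>] by blast
  note t = vcomp_iso[OF \<alpha> lwhisker_iso(1)[OF v(2) w2(1) \<psi>]]
    vcomp_hom[OF \<beta> whisker_hom2(1)[OF v(2) f2 iso2_hom2[OF \<psi>]]]
  have "sq w1 w2 (id2 C v1) \<psi> \<alpha> ((w2 \<triangleleft> \<psi>) \<bullet> \<alpha>)" "sq f1 f2 (id2 C v1) \<psi> \<beta> ((f2 \<triangleleft> \<psi>) \<bullet> \<beta>)"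
    using vcomp_id_right iso2_hom2[OF t(1)] t(2)
    by (simp_all add: sq_def lwhisker_id2[OF v(1) w1(1)] lwhisker_id2[OF v(1) f1])
  moreover have "id2 C v1 \<in> iso2 C v1 v1" using v id2_iso by (simp add: hom1_def)
  moreover have "(v1, v2', (w2 \<triangleleft> \<psi>) \<bullet> \<alpha>, (f2 \<triangleleft> \<psi>) \<bullet> \<beta>) \<in> squares X"
    using v v2' t by (simp add: squares_def)
  ultimately show ?thesis using d \<psi> unfolding square_iso_def by blast
qed

lemma rel_trans: "(x, y) \<in> rel \<Longrightarrow> (y, u) \<in> rel \<Longrightarrow> (x, u) \<in> rel"
  using equiv_rel by (meson equivE transD)

lemma rel_sym: "(x, y) \<in> rel \<Longrightarrow> (y, x) \<in> rel"
  using equiv_rel by (meson equivE symD)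

text \<open>Each adjustment refines the source and must keep both classes, so admissibility is
  carried through every stage; the first leg itself is brought into \<open>W\<close> only at the
  end.\<close>

lemma common_square:
  assumes d: "(X, d) \<in> rep" and d': "(X', d') \<in> rep"
  obtains Y v1 v2 \<alpha> \<gamma> \<gamma>' where "v1 \<in> W"
    "((X, d), (Y, v1, v2, \<alpha>, \<gamma>)) \<in> rel" "((X', d'), (Y, v1, v2, \<alpha>, \<gamma>')) \<in> rel"
proof -
  have s: "d \<in> squares X" "admissible d" and s': "d' \<in> squares X'" "admissible d'"
    using d d' by (simp_all add: rep_iff)
  have v: "fst d \<in> hom1 C X A1" "w1 \<odot> fst d \<in> W" and v': "fst d' \<in> hom1 C X' A1"
    using s s' by (auto simp: squares_def admissible_def)
  obtain V p q \<phi> where p: "p \<in> hom1 C V X" and q: "q \<in> hom1 C V X'" "q \<in> W"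
    and \<phi>: "\<phi> \<in> iso2 C (fst d \<odot> p) (fst d' \<odot> q)"
    by (rule weak_pullback[OF w1 v v'])
  obtain u1 u2 \<alpha> \<beta> where e: "pull d p = (u1, u2, \<alpha>, \<beta>)" by (cases "pull d p")
  obtain u1' u2' \<alpha>' \<beta>' where e': "pull d' q = (u1', u2', \<alpha>', \<beta>')" by (cases "pull d' q")
  have \<phi>: "\<phi> \<in> iso2 C u1 u1'"
    using \<phi> e e' by (auto simp: pull_def split: prod.splits)
  have es: "(u1, u2, \<alpha>, \<beta>) \<in> squares V" and e's: "(u1', u2', \<alpha>', \<beta>') \<in> squares V"
    using pull_squares[OF s(1) p] pull_squares[OF s'(1) q(1)] e e' by simp_all
  have u: "u1 \<in> hom1 C V A1" "u2 \<in> hom1 C V A2" "u2' \<in> hom1 C V A2"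
    and \<alpha>: "\<alpha> \<in> iso2 C (w1 \<odot> u1) (w2 \<odot> u2)" and \<beta>: "\<beta> \<in> hom2 C (f1 \<odot> u1) (f2 \<odot> u2)"
    using es e's by (auto simp: squares_def)
  define \<alpha>'' \<beta>'' where "\<alpha>'' = \<alpha>' \<bullet> (w1 \<triangleleft> \<phi>)" and "\<beta>'' = \<beta>' \<bullet> (f1 \<triangleleft> \<phi>)"
  have iso: "square_iso V (u1, u2', \<alpha>'', \<beta>'') (u1', u2', \<alpha>', \<beta>')"
    unfolding \<alpha>''_def \<beta>''_def by (rule square_iso_transport_left[OF e's u(1) \<phi>])
  have e''s: "(u1, u2', \<alpha>'', \<beta>'') \<in> squares V" by (rule square_iso_squares[OF iso])
  have \<alpha>'': "\<alpha>'' \<in> iso2 C (w1 \<odot> u1) (w2 \<odot> u2')" using e''s by (simp add: squares_def)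
  have ad': "admissible (u1', u2', \<alpha>', \<beta>')"
    using admissible_pull[OF s' q] e' by simp
  then have ad'': "admissible (u1, u2', \<alpha>'', \<beta>'')" using admissible_iso[OF iso] by blast
  \<comment> \<open>\<open>p\<close> need not lie in \<open>W\<close>. This datum is admissible
    because it shares its first leg with the other one, and admissibility sees only that
    leg.\<close>
  then have ad: "admissible (u1, u2, \<alpha>, \<beta>)" by (simp add: admissible_def)
  have rel1: "((X, d), (V, u1, u2, \<alpha>, \<beta>)) \<in> rel" using rel_pull[OF s p] ad e by simp
  have "((X', d'), (V, u1', u2', \<alpha>', \<beta>')) \<in> rel" using rel_pull[OF s' q(1)] ad' e' by simp
  then have rel2: "((X', d'), (V, u1, u2', \<alpha>'', \<beta>'')) \<in> rel"
    using rel_square_iso[OF iso ad''] rel_sym rel_trans by blast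
  \<comment> \<open>The discrepancy between the two invertible 2-cells over the common leg
    \<open>u1\<close>. It runs between composites with \<open>w2\<close>, so BF4 lifts a restriction
    of it to an isomorphism \<psi> of second legs.\<close>
  let ?\<kappa> = "\<alpha> \<bullet> inv2 C \<alpha>''"
  have \<kappa>: "?\<kappa> \<in> iso2 C (w2 \<odot> u2') (w2 \<odot> u2)" by (rule vcomp_iso[OF inv2_iso[OF \<alpha>''] \<alpha>])
  obtain U t \<psi> where t: "t \<in> hom1 C U V" "t \<in> W" and \<psi>: "\<psi> \<in> iso2 C (u2' \<odot> t) (u2 \<odot> t)"
    and \<kappa>\<psi>: "rw w2 u2' w2 u2 ?\<kappa> t = w2 \<triangleleft> \<psi>"
    using BF4ab[OF w2 u(3,2) iso2_hom2[OF \<kappa>]] \<kappa> unfolding BF4_triples_def by blast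
  define v1 v2 \<alpha>3 \<gamma> where "v1 = u1 \<odot> t" and "v2 = u2 \<odot> t" and "\<alpha>3 = rw w1 u1 w2 u2 \<alpha> t"
    and "\<gamma> = rw f1 u1 f2 u2 \<beta> t"
  define \<gamma>' where "\<gamma>' = (f2 \<triangleleft> \<psi>) \<bullet> rw f1 u1 f2 u2' \<beta>'' t"
  have p1: "pull (u1, u2, \<alpha>, \<beta>) t = (v1, v2, \<alpha>3, \<gamma>)" by (simp add: pull_def v1_def v2_def \<alpha>3_def \<gamma>_def)
  \<comment> \<open>Hence transport along \<psi> turns the restriction of \<open>\<alpha>''\<close>
    into exactly that of \<alpha>: the 2-cell \<open>\<alpha>3\<close> is shared, not just the
    legs.\<close>
  have "?\<kappa> \<bullet> \<alpha>'' = \<alpha>" by (simp add: cell_simps inv2_simps[OF \<alpha>''] inv2_simps[OF \<alpha>])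
  then have "\<alpha>3 = (w2 \<triangleleft> \<psi>) \<bullet> rw w1 u1 w2 u2' \<alpha>'' t"
    using rw_vcomp[OF t(1) u(1) w1(1) u(3) w2(1) u(2) w2(1) iso2_hom2[OF \<alpha>''] iso2_hom2[OF \<kappa>]]
    by (simp add: \<alpha>3_def \<kappa>\<psi>)
  then have iso': "square_iso U (pull (u1, u2', \<alpha>'', \<beta>'') t) (v1, v2, \<alpha>3, \<gamma>')"
    using square_iso_transport_right[OF pull_squares[OF e''s t(1), unfolded pull_def prod.case] \<psi>]
    by (simp add: pull_def v1_def v2_def \<gamma>'_def)
  note gs = pull_squares[OF es t(1), unfolded p1] and g's = square_iso_squares(2)[OF iso']
  have adg: "admissible (v1, v2, \<alpha>3, \<gamma>)" using admissible_pull[OF es ad t] p1 by simp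
  then have adg': "admissible (v1, v2, \<alpha>3, \<gamma>')" by (simp add: admissible_def)
  have rel3: "((X, d), (U, v1, v2, \<alpha>3, \<gamma>)) \<in> rel"
    using rel_trans[OF rel1 rel_pull[OF es ad t(1)]] adg p1 by simp
  have rel4: "((X', d'), (U, v1, v2, \<alpha>3, \<gamma>')) \<in> rel"
    using rel_trans[OF rel2 rel_trans[OF rel_pull[OF e''s ad'' t(1)] rel_square_iso[OF iso']]]
      admissible_pull[OF e''s ad'' t] by blast
  have v1: "v1 \<in> hom1 C U A1" "w1 \<odot> v1 \<in> W"
    using gs adg by (simp_all add: squares_def admissible_def)
  \<comment> \<open>Only \<open>w1 \<odot> v1\<close> is known to be in \<open>W\<close> so far.
    Restricting both data along the same \<open>r\<close> repairs this and keeps everything they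
    share.\<close>
  obtain Y r where r: "r \<in> hom1 C Y U" "v1 \<odot> r \<in> W"
    by (rule W_right_factor[OF w1 v1])
  have W: "w1 \<odot> (v1 \<odot> r) \<in> W" by (rule BF2[OF comp1_hom[OF r(1) v1(1)] w1(1) r(2) w1(2)])
  show thesis
    using that[OF r(2)] rel_trans[OF rel3 rel_pull[OF gs adg r(1)]]
      rel_trans[OF rel4 rel_pull[OF g's adg' r(1)]] W
    by (simp add: pull_def admissible_def)
qed

section \<open>Equality of 2-morphisms that differ only in the last component\<close>

text \<open>
  The two isomorphisms \<open>\<sigma>1\<close>, \<open>\<sigma>2\<close> relating the data become, after precomposition with suitable
  elements of \<open>W\<close>, whiskerings of a single \<open>\<tau>\<close>: local fullness of \<open>w1 \<odot> v1\<close> produces \<open>\<tau>\<close>, and local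
  faithfulness of \<open>w1\<close> and \<open>w2\<close> identifies \<open>\<sigma>1\<close> and \<open>\<sigma>2\<close> with \<open>v1 \<triangleleft> \<tau>\<close> and \<open>v2 \<triangleleft> \<tau>\<close>.
\<close>

lemma rel_parallel_imp:
  assumes rel: "((X, v1, v2, \<alpha>, \<gamma>), (X, v1, v2, \<alpha>, \<gamma>')) \<in> rel"
  obtains V x where "x \<in> hom1 C V X" "(w1 \<odot> v1) \<odot> x \<in> W" "\<gamma> \<triangleright> x = \<gamma>' \<triangleright> x"
proof -
  have d: "(v1, v2, \<alpha>, \<gamma>) \<in> squares X" "admissible (v1, v2, \<alpha>, \<gamma>)"
    and d': "(v1, v2, \<alpha>, \<gamma>') \<in> squares X"
    using rel by (simp_all add: rel_iff rep_iff)
  have v: "v1 \<in> hom1 C X A1" "v2 \<in> hom1 C X A2" and \<alpha>: "\<alpha> \<in> iso2 C (w1 \<odot> v1) (w2 \<odot> v2)"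
    and \<gamma>: "\<gamma> \<in> hom2 C (f1 \<odot> v1) (f2 \<odot> v2)" "\<gamma>' \<in> hom2 C (f1 \<odot> v1) (f2 \<odot> v2)"
    and wv: "w1 \<odot> v1 \<in> W"
    using d d' by (simp_all add: squares_def admissible_def)
  have wv1: "w1 \<odot> v1 \<in> hom1 C X A" by (rule comp1_hom[OF v(1) w1(1)])
  \<comment> \<open>The membership condition sits on \<open>z'\<close> because the final equation
    between \<gamma> and \<gamma>' is obtained along that leg.\<close>
  define linked where "linked V z z' \<sigma>1 \<sigma>2 \<longleftrightarrow> z \<in> hom1 C V X \<and> z' \<in> hom1 C V X \<and>
    (w1 \<odot> v1) \<odot> z' \<in> W \<and> \<sigma>1 \<in> iso2 C (v1 \<odot> z) (v1 \<odot> z') \<and> \<sigma>2 \<in> iso2 C (v2 \<odot> z) (v2 \<odot> z') \<and>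
    sq w1 w2 \<sigma>1 \<sigma>2 (rw w1 v1 w2 v2 \<alpha> z) (rw w1 v1 w2 v2 \<alpha> z') \<and>
    sq f1 f2 \<sigma>1 \<sigma>2 (rw f1 v1 f2 v2 \<gamma> z) (rw f1 v1 f2 v2 \<gamma>' z')" for V z z' \<sigma>1 \<sigma>2
  \<comment> \<open>Stability under restriction lets the comparisons be improved in stages, each of
    which costs one more element of \<open>W\<close>.\<close>
  have refine: "linked U (z \<odot> t) (z' \<odot> t) (rw v1 z v1 z' \<sigma>1 t) (rw v2 z v2 z' \<sigma>2 t)"
    if l: "linked V z z' \<sigma>1 \<sigma>2" and t: "t \<in> hom1 C U V" "t \<in> W" for U V z z' \<sigma>1 \<sigma>2 t
  proof -
    have z: "z \<in> hom1 C V X" "z' \<in> hom1 C V X" "(w1 \<odot> v1) \<odot> z' \<in> W"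
      and \<sigma>: "\<sigma>1 \<in> iso2 C (v1 \<odot> z) (v1 \<odot> z')" "\<sigma>2 \<in> iso2 C (v2 \<odot> z) (v2 \<odot> z')"
      and sq: "sq w1 w2 \<sigma>1 \<sigma>2 (rw w1 v1 w2 v2 \<alpha> z) (rw w1 v1 w2 v2 \<alpha> z')"
        "sq f1 f2 \<sigma>1 \<sigma>2 (rw f1 v1 f2 v2 \<gamma> z) (rw f1 v1 f2 v2 \<gamma>' z')"
      using l by (simp_all add: linked_def)
    note wz = comp1_hom[OF z(2) wv1]
    have "((w1 \<odot> v1) \<odot> z') \<odot> t \<in> W" by (rule BF2[OF t(1) wz t(2) z(3)])
    then have "(w1 \<odot> v1) \<odot> (z' \<odot> t) \<in> W"
      using W_iso[OF assoc_iso[OF t(1) z(2) wv1] comp1_hom[OF t(1) wz]] by blast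
    then show ?thesis
      using comp1_hom[OF t(1) z(1)] comp1_hom[OF t(1) z(2)]
        rw_iso[OF t(1) z(1) v(1) z(2) v(1) \<sigma>(1)] rw_iso[OF t(1) z(1) v(2) z(2) v(2) \<sigma>(2)]
        sq_rw[OF t(1) z(1,2) w1(1) w2(1) v v iso2_hom2[OF \<alpha>] iso2_hom2[OF \<alpha>]
          iso2_hom2[OF \<sigma>(1)] iso2_hom2[OF \<sigma>(2)] sq(1)]
        sq_rw[OF t(1) z(1,2) f1 f2 v v \<gamma> iso2_hom2[OF \<sigma>(1)] iso2_hom2[OF \<sigma>(2)] sq(2)]
      unfolding linked_def by blast
  qed
  obtain V z z' \<sigma>1 \<sigma>2 where l0: "linked V z z' \<sigma>1 \<sigma>2"
  proof -
    obtain V z z' where z: "z \<in> hom1 C V X" "z' \<in> hom1 C V X"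
      and ad: "admissible (pull (v1, v2, \<alpha>, \<gamma>) z)"
      and iso: "square_iso V (pull (v1, v2, \<alpha>, \<gamma>) z) (pull (v1, v2, \<alpha>, \<gamma>') z')"
      using rel unfolding rel_iff by blast
    have "(w1 \<odot> v1) \<odot> z' \<in> W"
      using ad admissible_iso[OF iso] admissible_pull_iff[OF d' z(2)] by simp
    then show thesis
      using that z iso unfolding square_iso_def pull_def linked_def by auto
  qed
  have z: "z \<in> hom1 C V X" "z' \<in> hom1 C V X" and \<sigma>1: "\<sigma>1 \<in> iso2 C (v1 \<odot> z) (v1 \<odot> z')"
    using l0 by (simp_all add: linked_def)
  note vz = comp1_hom[OF z(1) v(1)] comp1_hom[OF z(2) v(1)]
  note a = assoc_iso[OF z(1) v(1) w1(1)] assoc_iso[OF z(2) v(1) w1(1)]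
  \<comment> \<open>\<open>w1 \<triangleleft> \<sigma>1\<close> rebracketed with
    \<open>w1 \<odot> v1\<close> in front, since this composite, unlike \<open>v1\<close>, is known
    to be in \<open>W\<close> and BF4 can lift through it.\<close>
  let ?\<kappa> = "inv2 C (assoc C w1 v1 z') \<bullet> (w1 \<triangleleft> \<sigma>1) \<bullet> assoc C w1 v1 z"
  have \<kappa>: "?\<kappa> \<in> iso2 C ((w1 \<odot> v1) \<odot> z) ((w1 \<odot> v1) \<odot> z')"
    using vcomp_iso[OF vcomp_iso[OF a(1) lwhisker_iso(1)[OF vz(1) w1(1) \<sigma>1]] inv2_iso[OF a(2)]]
    by simp
  have \<kappa>': "assoc C w1 v1 z' \<bullet> ?\<kappa> \<bullet> inv2 C (assoc C w1 v1 z) = w1 \<triangleleft> \<sigma>1"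
    using z v w1 inv2_simps[OF lwhisker_iso(1)[OF vz(1) w1(1) \<sigma>1]] by (simp add: cell_simps)
  obtain U t \<tau> where t: "t \<in> hom1 C U V" "t \<in> W" and \<tau>: "\<tau> \<in> iso2 C (z \<odot> t) (z' \<odot> t)"
    and \<kappa>\<tau>: "rw (w1 \<odot> v1) z (w1 \<odot> v1) z' ?\<kappa> t = (w1 \<odot> v1) \<triangleleft> \<tau>"
    using BF4ab[OF wv1 wv z iso2_hom2[OF \<kappa>]] \<kappa> unfolding BF4_triples_def by blast
  note zt = comp1_hom[OF t(1) z(1)] comp1_hom[OF t(1) z(2)]
  note vzt = comp1_hom[OF zt(1) v(1)] comp1_hom[OF zt(2) v(1)]
  let ?\<rho>1 = "rw v1 z v1 z' \<sigma>1 t" and ?\<rho>2 = "rw v2 z v2 z' \<sigma>2 t"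
  have l1: "linked U (z \<odot> t) (z' \<odot> t) ?\<rho>1 ?\<rho>2" by (rule refine[OF l0 t])
  have \<rho>1: "?\<rho>1 \<in> hom2 C (v1 \<odot> (z \<odot> t)) (v1 \<odot> (z' \<odot> t))"
    using l1 iso2_hom2 by (simp add: linked_def)
  have v\<tau>: "v1 \<triangleleft> \<tau> \<in> hom2 C (v1 \<odot> (z \<odot> t)) (v1 \<odot> (z' \<odot> t))"
    by (rule whisker_hom2(1)[OF zt(1) v(1) iso2_hom2[OF \<tau>]])
  \<comment> \<open>As \<tau> was lifted through \<open>w1 \<odot> v1\<close>, the 2-cells
    \<open>?\<rho>1\<close> and \<open>v1 \<triangleleft> \<tau>\<close> can be compared only under
    \<open>w1\<close>; \<open>assoc_rw\<close> reconciles the bracketings.\<close>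
  have "w1 \<triangleleft> ?\<rho>1 = w1 \<triangleleft> (v1 \<triangleleft> \<tau>)"
  proof -
    let ?a = "assoc C v1 z t" and ?a' = "assoc C v1 z' t"
    have b: "?a \<in> iso2 C ((v1 \<odot> z) \<odot> t) (v1 \<odot> (z \<odot> t))" "?a' \<in> iso2 C ((v1 \<odot> z') \<odot> t) (v1 \<odot> (z' \<odot> t))"
      using assoc_iso t z v by blast+
    have c: "(v1 \<odot> z) \<odot> t \<in> hom1 C U A1" "(v1 \<odot> z') \<odot> t \<in> hom1 C U A1"
      using comp1_hom[OF t(1) vz(1)] comp1_hom[OF t(1) vz(2)] .
    have st: "\<sigma>1 \<triangleright> t \<in> hom2 C ((v1 \<odot> z) \<odot> t) ((v1 \<odot> z') \<odot> t)"
      by (rule whisker_hom2(2)[OF t(1) vz(1) iso2_hom2[OF \<sigma>1]])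
    have "?\<rho>1 \<bullet> ?a = ?a' \<bullet> (\<sigma>1 \<triangleright> t)"
      using st inv2_simps[OF b(1)] inv2_simps[OF b(2)]
      by (simp add: rwhisker_assoc_def cell_simps)
    then have "(w1 \<triangleleft> ?\<rho>1) \<bullet> (w1 \<triangleleft> ?a) = (w1 \<triangleleft> ?a') \<bullet> (w1 \<triangleleft> (\<sigma>1 \<triangleright> t))"
      using lwhisker_vcomp[OF c(1) w1(1) iso2_hom2[OF b(1)] \<rho>1]
        lwhisker_vcomp[OF c(1) w1(1) st iso2_hom2[OF b(2)]] by simp
    also have "\<dots> = (w1 \<triangleleft> ?a') \<bullet> rw w1 (v1 \<odot> z) w1 (v1 \<odot> z') (w1 \<triangleleft> \<sigma>1) t"
      using rw_lwhisker[OF t(1) vz(1) w1(1) iso2_hom2[OF \<sigma>1]] by simp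
    also have "\<dots> = (assoc C w1 v1 (z' \<odot> t) \<bullet> ((w1 \<odot> v1) \<triangleleft> \<tau>) \<bullet> inv2 C (assoc C w1 v1 (z \<odot> t)))
        \<bullet> (w1 \<triangleleft> ?a)"
      using assoc_rw[OF t(1) z v(1) v(1) w1(1) w1(1) iso2_hom2[OF \<kappa>]] unfolding \<kappa>' \<kappa>\<tau> .
    finally have "w1 \<triangleleft> ?\<rho>1 = assoc C w1 v1 (z' \<odot> t) \<bullet> ((w1 \<odot> v1) \<triangleleft> \<tau>) \<bullet> inv2 C (assoc C w1 v1 (z \<odot> t))"
      by (rule iso2_cancel_right[OF lwhisker_iso(1)[OF c(1) w1(1) b(1)], rotated -1])
        (use whisker_hom2(1)[OF vzt(1) w1(1) \<rho>1] whisker_hom2(1)[OF zt(1) wv1 iso2_hom2[OF \<tau>]]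
          inv2_simps[OF assoc_iso[OF zt(1) v(1) w1(1)]] inv2_simps[OF assoc_iso[OF zt(2) v(1) w1(1)]]
          in \<open>simp_all add: hom2_def vcomp_simps\<close>)
    also have "\<dots> = ((w1 \<triangleleft> (v1 \<triangleleft> \<tau>)) \<bullet> assoc C w1 v1 (z \<odot> t)) \<bullet> inv2 C (assoc C w1 v1 (z \<odot> t))"
      unfolding assoc_lwhisker[OF zt(1) v(1) w1(1) iso2_hom2[OF \<tau>], symmetric]
      using whisker_hom2(1)[OF zt(1) wv1 iso2_hom2[OF \<tau>]]
        inv2_simps[OF assoc_iso[OF zt(1) v(1) w1(1)]] inv2_simps[OF assoc_iso[OF zt(2) v(1) w1(1)]]
      by (simp add: hom2_def vcomp_ac)
    also have "\<dots> = w1 \<triangleleft> (v1 \<triangleleft> \<tau>)"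
      using inv2_simps[OF assoc_iso[OF zt(1) v(1) w1(1)]] whisker_hom2(1)[OF vzt(1) w1(1) v\<tau>]
      by (simp add: hom2_def vcomp_ac vcomp_id)
    finally show ?thesis .
  qed
  then obtain U' u where u: "u \<in> hom1 C U' U" "u \<in> W" and u_eq: "?\<rho>1 \<triangleright> u = (v1 \<triangleleft> \<tau>) \<triangleright> u"
    by (rule W_locally_faithful[OF w1 vzt \<rho>1 v\<tau>])
  define y y' \<tau>2 \<sigma>3 where "y = (z \<odot> t) \<odot> u" and "y' = (z' \<odot> t) \<odot> u" and "\<tau>2 = \<tau> \<triangleright> u"
    and "\<sigma>3 = rw v2 (z \<odot> t) v2 (z' \<odot> t) ?\<rho>2 u"
  have \<tau>2: "\<tau>2 \<in> iso2 C y y'"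
    using rwhisker_iso[OF u(1) zt(1) \<tau>] by (simp add: \<tau>2_def y_def y'_def)
  have "rw v1 (z \<odot> t) v1 (z' \<odot> t) ?\<rho>1 u = v1 \<triangleleft> \<tau>2"
    using rw_lwhisker[OF u(1) zt(1) v(1) iso2_hom2[OF \<tau>]] u_eq
    by (simp add: rwhisker_assoc_def \<tau>2_def)
  then have l2: "linked U' y y' (v1 \<triangleleft> \<tau>2) \<sigma>3"
    using refine[OF l1 u] by (simp add: y_def y'_def \<sigma>3_def)
  have y: "y \<in> hom1 C U' X" "y' \<in> hom1 C U' X" and \<sigma>3: "\<sigma>3 \<in> iso2 C (v2 \<odot> y) (v2 \<odot> y')"
    and sq: "sq w1 w2 (v1 \<triangleleft> \<tau>2) \<sigma>3 (rw w1 v1 w2 v2 \<alpha> y) (rw w1 v1 w2 v2 \<alpha> y')"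
    using l2 by (simp_all add: linked_def)
  note vy = comp1_hom[OF y(1) v(2)] comp1_hom[OF y(2) v(2)]
  have v\<tau>2: "v2 \<triangleleft> \<tau>2 \<in> hom2 C (v2 \<odot> y) (v2 \<odot> y')"
    by (rule whisker_hom2(1)[OF y(1) v(2) iso2_hom2[OF \<tau>2]])
  \<comment> \<open>The square for \<alpha> and naturality of its restriction at
    \<open>\<tau>2\<close> share the side \<open>v1 \<triangleleft> \<tau>2\<close>. Invertibility
    of \<alpha> thus makes the first comparison determine the second, under
    \<open>w2\<close>.\<close>
  have "(w2 \<triangleleft> \<sigma>3) \<bullet> rw w1 v1 w2 v2 \<alpha> y = (w2 \<triangleleft> (v2 \<triangleleft> \<tau>2)) \<bullet> rw w1 v1 w2 v2 \<alpha> y"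
    using sq rw_natural[OF y(1) v(1) w1(1) v(2) w2(1) iso2_hom2[OF \<alpha>] iso2_hom2[OF \<tau>2]]
    by (simp add: sq_def)
  then have "w2 \<triangleleft> \<sigma>3 = w2 \<triangleleft> (v2 \<triangleleft> \<tau>2)"
    by (rule iso2_cancel_right[OF rw_iso[OF y(1) v(1) w1(1) v(2) w2(1) \<alpha>], rotated -1])
      (use whisker_hom2(1)[OF vy(1) w2(1) iso2_hom2[OF \<sigma>3]] whisker_hom2(1)[OF vy(1) w2(1) v\<tau>2]
        in \<open>simp_all add: hom2_def\<close>)
  then obtain U'' s where s: "s \<in> hom1 C U'' U'" "s \<in> W" and s_eq: "\<sigma>3 \<triangleright> s = (v2 \<triangleleft> \<tau>2) \<triangleright> s"
    by (rule W_locally_faithful[OF w2 vy iso2_hom2[OF \<sigma>3] v\<tau>2])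
  have \<tau>3: "\<tau>2 \<triangleright> s \<in> hom2 C (y \<odot> s) (y' \<odot> s)"
    by (rule whisker_hom2(2)[OF s(1) y(1) iso2_hom2[OF \<tau>2]])
  have "rw v2 y v2 y' \<sigma>3 s = v2 \<triangleleft> (\<tau>2 \<triangleright> s)"
    using rw_lwhisker[OF s(1) y(1) v(2) iso2_hom2[OF \<tau>2]] s_eq by (simp add: rwhisker_assoc_def)
  then have l3: "linked U'' (y \<odot> s) (y' \<odot> s) (v1 \<triangleleft> (\<tau>2 \<triangleright> s)) (v2 \<triangleleft> (\<tau>2 \<triangleright> s))"
    using refine[OF l2 s] rw_lwhisker[OF s(1) y(1) v(1) iso2_hom2[OF \<tau>2]] by simp
  note ys = comp1_hom[OF s(1) y(1)] comp1_hom[OF s(1) y(2)]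
  have v\<tau>3: "v1 \<triangleleft> (\<tau>2 \<triangleright> s) \<in> iso2 C (v1 \<odot> (y \<odot> s)) (v1 \<odot> (y' \<odot> s))"
    using l3 by (simp add: linked_def)
  \<comment> \<open>Both comparisons now come from one 2-cell, so naturality gives a square from
    \<gamma> to \<gamma> with the same sides as the linking square from \<gamma> to
    \<gamma>'.\<close>
  have "rw f1 v1 f2 v2 \<gamma> (y' \<odot> s) \<bullet> (f1 \<triangleleft> (v1 \<triangleleft> (\<tau>2 \<triangleright> s)))
      = rw f1 v1 f2 v2 \<gamma>' (y' \<odot> s) \<bullet> (f1 \<triangleleft> (v1 \<triangleleft> (\<tau>2 \<triangleright> s)))"
    using l3 rw_natural[OF ys(1) v(1) f1 v(2) f2 \<gamma>(1) \<tau>3] by (simp add: linked_def sq_def)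
  then have "rw f1 v1 f2 v2 \<gamma> (y' \<odot> s) = rw f1 v1 f2 v2 \<gamma>' (y' \<odot> s)"
    by (rule iso2_cancel_right[OF lwhisker_iso(1)[OF comp1_hom[OF ys(1) v(1)] f1 v\<tau>3], rotated -1])
      (use rw_hom2[OF ys(2) v(1) f1 v(2) f2 \<gamma>(1)] rw_hom2[OF ys(2) v(1) f1 v(2) f2 \<gamma>(2)]
        in \<open>simp_all add: hom2_def\<close>)
  then have "\<gamma> \<triangleright> (y' \<odot> s) = \<gamma>' \<triangleright> (y' \<odot> s)" by (rule rw_cancel[OF ys(2) v(1) f1 v(2) f2 \<gamma>])
  then show thesis using that ys(2) l3 by (simp add: linked_def)
qed

text \<open>For the converse, the restrictions of the two data along \<open>z\<close> are equal as
  tuples, so reflexivity of \<open>square_iso\<close> suffices.\<close>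

lemma rel_parallel_iff:
  assumes d: "(X, v1, v2, \<alpha>, \<gamma>) \<in> rep" and d': "(X, v1, v2, \<alpha>, \<gamma>') \<in> rep"
  shows "((X, v1, v2, \<alpha>, \<gamma>), (X, v1, v2, \<alpha>, \<gamma>')) \<in> rel \<longleftrightarrow>
    (\<exists>V z. z \<in> hom1 C V X \<and> (w1 \<odot> v1) \<odot> z \<in> W \<and> \<gamma> \<triangleright> z = \<gamma>' \<triangleright> z)"
proof
  assume "((X, v1, v2, \<alpha>, \<gamma>), (X, v1, v2, \<alpha>, \<gamma>')) \<in> rel"
  then show "\<exists>V z. z \<in> hom1 C V X \<and> (w1 \<odot> v1) \<odot> z \<in> W \<and> \<gamma> \<triangleright> z = \<gamma>' \<triangleright> z"
    by (rule rel_parallel_imp) blast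
next
  assume "\<exists>V z. z \<in> hom1 C V X \<and> (w1 \<odot> v1) \<odot> z \<in> W \<and> \<gamma> \<triangleright> z = \<gamma>' \<triangleright> z"
  then obtain V z where z: "z \<in> hom1 C V X" "(w1 \<odot> v1) \<odot> z \<in> W" "\<gamma> \<triangleright> z = \<gamma>' \<triangleright> z" by blast
  have s: "(v1, v2, \<alpha>, \<gamma>) \<in> squares X" using d by (simp add: rep_iff)
  have "pull (v1, v2, \<alpha>, \<gamma>) z = pull (v1, v2, \<alpha>, \<gamma>') z"
    using z(3) by (simp add: pull_def rwhisker_assoc_def)
  then show "((X, v1, v2, \<alpha>, \<gamma>), (X, v1, v2, \<alpha>, \<gamma>')) \<in> rel"
    using d d' z admissible_pull_iff[OF s z(1)] square_iso_refl[OF pull_squares[OF s z(1)]]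
    unfolding rel_iff by (metis fst_conv)
qed

text \<open>Each of the two memberships implies that of \<open>(w1 \<odot> v1) \<odot> z\<close> by
  BF2. In the other direction \<open>W_right_factor\<close> is used twice, cancelling
  \<open>w1 \<odot> v1\<close> or only \<open>w1\<close>, each time after a further restriction of
  \<open>z\<close>.\<close>

lemma rel_parallel_iff_W:
  assumes d: "(X, v1, v2, \<alpha>, \<gamma>) \<in> rep" and d': "(X, v1, v2, \<alpha>, \<gamma>') \<in> rep"
  shows "((X, v1, v2, \<alpha>, \<gamma>), (X, v1, v2, \<alpha>, \<gamma>')) \<in> rel \<longleftrightarrow>
      (\<exists>V z. V \<in> Obj C \<and> z \<in> hom1 C V X \<and> z \<in> W \<and> \<gamma> \<triangleright> z = \<gamma>' \<triangleright> z)"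
    and "((X, v1, v2, \<alpha>, \<gamma>), (X, v1, v2, \<alpha>, \<gamma>')) \<in> rel \<longleftrightarrow>
      (\<exists>V z. V \<in> Obj C \<and> z \<in> hom1 C V X \<and> v1 \<odot> z \<in> W \<and> \<gamma> \<triangleright> z = \<gamma>' \<triangleright> z)"
proof -
  have v: "v1 \<in> hom1 C X A1" "v2 \<in> hom1 C X A2" "w1 \<odot> v1 \<in> W"
    and \<gamma>: "\<gamma> \<in> hom2 C (f1 \<odot> v1) (f2 \<odot> v2)" "\<gamma>' \<in> hom2 C (f1 \<odot> v1) (f2 \<odot> v2)"
    using d d' by (simp_all add: frac_rep_def)
  note wv = comp1_hom[OF v(1) w1(1)] and fv = comp1_hom[OF v(1) f1]
  have brk: "(w1 \<odot> v1) \<odot> z \<in> W \<longleftrightarrow> w1 \<odot> (v1 \<odot> z) \<in> W" if "z \<in> hom1 C V X" for V z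
    by (rule W_iso[OF assoc_iso[OF that v(1) w1(1)] comp1_hom[OF that wv]])
  have obj: "V \<in> Obj C" if "z \<in> hom1 C V X" for V z
    using that src_Obj by (auto simp: hom1_def)
  \<comment> \<open>Whiskering by \<open>z \<odot> p\<close> is determined by whiskering by
    \<open>z\<close>, so the equation persists under refinement.\<close>
  have pull_eq: "\<gamma> \<triangleright> (z \<odot> p) = \<gamma>' \<triangleright> (z \<odot> p)"
    if "z \<in> hom1 C V X" "p \<in> hom1 C U V" "\<gamma> \<triangleright> z = \<gamma>' \<triangleright> z" for U V z p
  proof -
    have "\<gamma> \<triangleright> (z \<odot> p) = rw (f1 \<odot> v1) z (f2 \<odot> v2) z (\<gamma> \<triangleright> z) p"
      using rw_rwhisker[OF that(2,1) fv \<gamma>(1)] by simp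
    also have "\<dots> = \<gamma>' \<triangleright> (z \<odot> p)"
      using rw_rwhisker[OF that(2,1) fv \<gamma>(2)] that(3) by simp
    finally show ?thesis .
  qed
  have "\<exists>V z. V \<in> Obj C \<and> z \<in> hom1 C V X \<and> z \<in> W \<and> \<gamma> \<triangleright> z = \<gamma>' \<triangleright> z"
    "\<exists>V z. V \<in> Obj C \<and> z \<in> hom1 C V X \<and> v1 \<odot> z \<in> W \<and> \<gamma> \<triangleright> z = \<gamma>' \<triangleright> z"
    if z: "z \<in> hom1 C V X" "(w1 \<odot> v1) \<odot> z \<in> W" "\<gamma> \<triangleright> z = \<gamma>' \<triangleright> z" for V z
  proof -
    obtain U p where p: "p \<in> hom1 C U V" "z \<odot> p \<in> W"
      by (rule W_right_factor[OF wv v(3) z(1,2)])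
    show "\<exists>V z. V \<in> Obj C \<and> z \<in> hom1 C V X \<and> z \<in> W \<and> \<gamma> \<triangleright> z = \<gamma>' \<triangleright> z"
      using obj[OF comp1_hom[OF p(1) z(1)]] comp1_hom[OF p(1) z(1)] p(2) pull_eq[OF z(1) p(1) z(3)]
      by blast
    note vz = comp1_hom[OF z(1) v(1)]
    have "w1 \<odot> (v1 \<odot> z) \<in> W" using brk z by blast
    then obtain U' p' where p': "p' \<in> hom1 C U' V" "(v1 \<odot> z) \<odot> p' \<in> W"
      by (rule W_right_factor[OF w1 vz])
    have "v1 \<odot> (z \<odot> p') \<in> W"
      using W_iso[OF assoc_iso[OF p'(1) z(1) v(1)] comp1_hom[OF p'(1) vz]] p'(2) by blast
    then show "\<exists>V z. V \<in> Obj C \<and> z \<in> hom1 C V X \<and> v1 \<odot> z \<in> W \<and> \<gamma> \<triangleright> z = \<gamma>' \<triangleright> z"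
      using obj[OF comp1_hom[OF p'(1) z(1)]] comp1_hom[OF p'(1) z(1)] pull_eq[OF z(1) p'(1) z(3)]
      by blast
  qed
  moreover have "(w1 \<odot> v1) \<odot> z \<in> W" if "z \<in> hom1 C V X" "z \<in> W" for V z
    by (rule BF2[OF that(1) wv that(2) v(3)])
  moreover have "(w1 \<odot> v1) \<odot> z \<in> W" if "z \<in> hom1 C V X" "v1 \<odot> z \<in> W" for V z
    using BF2[OF comp1_hom[OF that(1) v(1)] w1(1) that(2) w1(2)] brk[OF that(1)] by blast
  ultimately show "((X, v1, v2, \<alpha>, \<gamma>), (X, v1, v2, \<alpha>, \<gamma>')) \<in> rel \<longleftrightarrow>
      (\<exists>V z. V \<in> Obj C \<and> z \<in> hom1 C V X \<and> z \<in> W \<and> \<gamma> \<triangleright> z = \<gamma>' \<triangleright> z)"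
    "((X, v1, v2, \<alpha>, \<gamma>), (X, v1, v2, \<alpha>, \<gamma>')) \<in> rel \<longleftrightarrow>
      (\<exists>V z. V \<in> Obj C \<and> z \<in> hom1 C V X \<and> v1 \<odot> z \<in> W \<and> \<gamma> \<triangleright> z = \<gamma>' \<triangleright> z)"
    unfolding rel_parallel_iff[OF d d'] by blast+
qed

end

theorem proposition1p1:
  fixes C :: "('o, 'm, 'c) bicat" (structure)
    and W :: "'m set"
    and A B A1 A2 :: 'o
    and w1 f1 w2 f2 :: 'm
    and \<Gamma> \<Gamma>' :: "('o \<times> 'm \<times> 'm \<times> 'c \<times> 'c) set"
  assumes "BF C W"
    and "A \<in> Obj C" and "B \<in> Obj C"
    and "(A1, w1, f1) \<in> frac_mor C W A B"
    and "(A2, w2, f2) \<in> frac_mor C W A B"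
    and "\<Gamma> \<in> frac_cell C W (A1, w1, f1) (A2, w2, f2)"
    and "\<Gamma>' \<in> frac_cell C W (A1, w1, f1) (A2, w2, f2)"
  shows
    "(\<exists>A3 v1 v2 \<alpha> \<gamma> \<gamma>'.
        A3 \<in> Obj C \<and> v1 \<in> hom1 C A3 A1 \<and> v1 \<in> W \<and> v2 \<in> hom1 C A3 A2 \<and>
        \<alpha> \<in> iso2 C (w1 \<odot> v1) (w2 \<odot> v2) \<and>
        \<gamma> \<in> hom2 C (f1 \<odot> v1) (f2 \<odot> v2) \<and> \<gamma>' \<in> hom2 C (f1 \<odot> v1) (f2 \<odot> v2) \<and>
        \<Gamma> = frac_class C W (A1, w1, f1) (A2, w2, f2) (A3, v1, v2, \<alpha>, \<gamma>) \<and>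
        \<Gamma>' = frac_class C W (A1, w1, f1) (A2, w2, f2) (A3, v1, v2, \<alpha>, \<gamma>'))
     \<and>
     (\<forall>A3 v1 v2 \<alpha> \<gamma> \<gamma>'.
        (A3, v1, v2, \<alpha>, \<gamma>) \<in> frac_rep C W (A1, w1, f1) (A2, w2, f2) \<and>
        (A3, v1, v2, \<alpha>, \<gamma>') \<in> frac_rep C W (A1, w1, f1) (A2, w2, f2) \<and>
        \<Gamma> = frac_class C W (A1, w1, f1) (A2, w2, f2) (A3, v1, v2, \<alpha>, \<gamma>) \<and>
        \<Gamma>' = frac_class C W (A1, w1, f1) (A2, w2, f2) (A3, v1, v2, \<alpha>, \<gamma>')
        \<longrightarrow>
        (\<Gamma> = \<Gamma>' \<longleftrightarrow>
           (\<exists>A4 z. A4 \<in> Obj C \<and> z \<in> hom1 C A4 A3 \<and> z \<in> W \<and> \<gamma> \<triangleright> z = \<gamma>' \<triangleright> z)) \<and>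
        (\<Gamma> = \<Gamma>' \<longleftrightarrow>
           (\<exists>A4 z. A4 \<in> Obj C \<and> z \<in> hom1 C A4 A3 \<and> v1 \<odot> z \<in> W \<and> \<gamma> \<triangleright> z = \<gamma>' \<triangleright> z)))"
proof -
  interpret frac_pair C W A B A1 A2 w1 f1 w2 f2
    using assms by (simp add: frac_pair_def frac_pair_axioms_def frac_mor_def)
  \<comment> \<open>Since \<open>rel\<close> is an equivalence on \<open>rep\<close>, equality of
    classes in both clauses becomes relatedness of representatives.\<close>
  have class_eq: "frac_class C W (A1, w1, f1) (A2, w2, f2) x = frac_class C W (A1, w1, f1) (A2, w2, f2) y
      \<longleftrightarrow> (x, y) \<in> rel" if "x \<in> rep" "y \<in> rep" for x y
    unfolding frac_class_def using that by (intro eq_equiv_class_iff[OF equiv_rel])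
  have "\<exists>A3 v1 v2 \<alpha> \<gamma> \<gamma>'.
        A3 \<in> Obj C \<and> v1 \<in> hom1 C A3 A1 \<and> v1 \<in> W \<and> v2 \<in> hom1 C A3 A2 \<and>
        \<alpha> \<in> iso2 C (w1 \<odot> v1) (w2 \<odot> v2) \<and>
        \<gamma> \<in> hom2 C (f1 \<odot> v1) (f2 \<odot> v2) \<and> \<gamma>' \<in> hom2 C (f1 \<odot> v1) (f2 \<odot> v2) \<and>
        \<Gamma> = frac_class C W (A1, w1, f1) (A2, w2, f2) (A3, v1, v2, \<alpha>, \<gamma>) \<and>
        \<Gamma>' = frac_class C W (A1, w1, f1) (A2, w2, f2) (A3, v1, v2, \<alpha>, \<gamma>')"
  proof -
    obtain X d X' d' where r: "(X, d) \<in> rep" "(X', d') \<in> rep"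
      and \<Gamma>: "\<Gamma> = frac_class C W (A1, w1, f1) (A2, w2, f2) (X, d)"
        "\<Gamma>' = frac_class C W (A1, w1, f1) (A2, w2, f2) (X', d')"
      using assms(6,7) unfolding frac_cell_def frac_class_def by (auto elim!: quotientE)
    obtain Y v1 v2 \<alpha> \<gamma> \<gamma>' where W: "v1 \<in> W"
      and rel: "((X, d), (Y, v1, v2, \<alpha>, \<gamma>)) \<in> rel" "((X', d'), (Y, v1, v2, \<alpha>, \<gamma>')) \<in> rel"
      by (rule common_square[OF r])
    have r': "(Y, v1, v2, \<alpha>, \<gamma>) \<in> rep" "(Y, v1, v2, \<alpha>, \<gamma>') \<in> rep"
      using rel by (simp_all add: rel_iff)
    then have "v1 \<in> hom1 C Y A1" "v2 \<in> hom1 C Y A2" "\<alpha> \<in> iso2 C (w1 \<odot> v1) (w2 \<odot> v2)"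
      "\<gamma> \<in> hom2 C (f1 \<odot> v1) (f2 \<odot> v2)" "\<gamma>' \<in> hom2 C (f1 \<odot> v1) (f2 \<odot> v2)"
      by (simp_all add: frac_rep_def)
    moreover from this(1) have "Y \<in> Obj C" using src_Obj by (auto simp: hom1_def)
    moreover note W class_eq[OF r(1) r'(1)] class_eq[OF r(2) r'(2)]
    ultimately show ?thesis using rel unfolding \<Gamma> by blast
  qed
  then show ?thesis
    by (rule conjI, intro allI impI, elim conjE, simp only: class_eq, intro conjI rel_parallel_iff_W)
qed

end
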